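(* Let $p$ be a prime and let $\overline{E}_p(x)\in\mathbb{F}_p[[x]]$ be the reduction modulo $p$ of the Artin–Hasse exponential $E_p(x)=\exp\left(\sum_{n\ge 0} x^{p^n}/p^n\right)\in\mathbb{Z}_{(p)}[[x]]$. Then $\overline{E}_p(x)$ is transcendental over $\mathbb{F}_p[x]$.
   Context: The Artin–Hasse exponential $E_p(x)=\exp\left(\sum_{n=0}^\infty \frac{x^{p^n}}{p^n}\right)$ has coefficients in $\mathbb{Z}_{(p)}$, so its coefficientwise reduction modulo $p$ is a well-defined element $\overline{E}_p(x)$ of $\mathbb{F}_p[[x]]$. *)

theory Defs
  imports
    "Berlekamp_Zassenhaus.Finite_Field"
    "HOL-Computational_Algebra.Computational_Algebra"
begin

text \<open>
  The infinite sum is taken in the X-adic topology on formal power series; it converges for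
  every p > 1 by the lemma below. Composition is legitimate because the constant coefficient
  of the inner series vanishes.
\<close>

definition artin_hasse_log :: "nat \<Rightarrow> rat fps" where
  "artin_hasse_log p = (\<Sum>n. fps_const (1 / of_nat (p ^ n)) * fps_X ^ (p ^ n))"

definition artin_hasse :: "nat \<Rightarrow> rat fps" where
  "artin_hasse p = fps_exp 1 oo artin_hasse_log p"

lemma artin_hasse_log_sums:
  assumes "p > 1"
  shows "(\<lambda>n. fps_const (1 / of_nat (p ^ n)) * fps_X ^ (p ^ n)) sums
           Abs_fps (\<lambda>m. if \<exists>n. m = p ^ n then 1 / of_nat m else (0::rat))"
  unfolding sums_def
proof (rule tendsto_fpsI)
  fix m :: nat
  have coeff: "fps_nth (\<Sum>n<N. fps_const (1 / of_nat (p ^ n)) * fps_X ^ (p ^ n)) m =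
          (if \<exists>n. m = p ^ n then 1 / of_nat m else (0::rat))" if N: "N > m" for N
  proof (cases "\<exists>n. m = p ^ n")
    case True
    then obtain n where n: "m = p ^ n" by blast
    have "n < p ^ n" using assms by (simp add: power_gt_expt)
    hence "n < N" using N n by simp
    have "fps_nth (\<Sum>n<N. fps_const (1 / of_nat (p ^ n)) * fps_X ^ (p ^ n)) m =
            (\<Sum>k<N. if k = n then 1 / of_nat m else (0::rat))"
      unfolding fps_sum_nth n using assms by (intro sum.cong) (auto simp: fps_X_power_nth)
    thus ?thesis using \<open>n < N\<close> True by simp
  next
    case False
    thus ?thesis unfolding fps_sum_nth by (auto simp: fps_X_power_nth intro!: sum.neutral)
  qed
  show "\<forall>\<^sub>F N in sequentially.
          fps_nth (\<Sum>n<N. fps_const (1 / of_nat (p ^ n)) * fps_X ^ (p ^ n)) m =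
          fps_nth (Abs_fps (\<lambda>m. if \<exists>n. m = p ^ n then 1 / of_nat m else (0::rat))) m"
    using eventually_gt_at_top[of m] by eventually_elim (simp only: coeff fps_nth_Abs_fps)
qed

lemma artin_hasse_log_eq:
  "p > 1 \<Longrightarrow> artin_hasse_log p =
     Abs_fps (\<lambda>m. if \<exists>n. m = p ^ n then 1 / of_nat m else 0)"
  unfolding artin_hasse_log_def by (rule sums_unique[OF artin_hasse_log_sums, symmetric])

text \<open>
  On rationals whose denominator is not divisible by p = CARD('p), this is the canonical ring
  homomorphism from the localisation of the integers at p onto the field with p elements.
  Elsewhere its value is an irrelevant 0, since the coefficients of the Artin--Hasse exponential
  are p-integral.
\<close>

definition rat_reduce :: "rat \<Rightarrow> 'p::prime_card mod_ring" where
  "rat_reduce r = of_int (fst (quotient_of r)) / of_int (snd (quotient_of r))"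

lemma of_int_mod_ring_eq_0_iff:
  "(of_int a :: 'p::prime_card mod_ring) = 0 \<longleftrightarrow> int CARD('p) dvd a"
  unfolding of_int_of_int_mod_ring by transfer (simp add: dvd_eq_mod_eq_0)

lemma rat_reduce_divide:
  assumes "\<not> int CARD('p) dvd b"
  shows "(rat_reduce (of_int a / of_int b) :: 'p::prime_card mod_ring) = of_int a / of_int b"
proof -
  obtain c d where cd: "quotient_of (of_int a / of_int b) = (c, d)" by fastforce
  have b0: "b \<noteq> 0" using assms by auto
  have d0: "d > 0" using quotient_of_denom_pos[OF cd] .
  have "of_int a / of_int b = (of_int c / of_int d :: rat)" by (rule quotient_of_div[OF cd])
  hence "(of_int (a * d) :: rat) = of_int (c * b)" using b0 d0 by (simp add: field_simps)
  hence eq: "a * d = c * b" by (simp only: of_int_eq_iff)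
  have "d dvd b"
    using eq quotient_of_coprime[OF cd] by (metis coprime_commute coprime_dvd_mult_right_iff dvd_triv_right)
  hence nd: "(of_int d :: 'p mod_ring) \<noteq> 0" "(of_int b :: 'p mod_ring) \<noteq> 0"
    using assms by (auto simp: of_int_mod_ring_eq_0_iff)
  have "(of_int a * of_int d :: 'p mod_ring) = of_int c * of_int b"
    using eq by (metis of_int_mult)
  thus ?thesis using nd by (simp add: rat_reduce_def cd field_simps)
qed

definition fps_reduce :: "rat fps \<Rightarrow> 'p::prime_card mod_ring fps" where
  "fps_reduce F = Abs_fps (\<lambda>n. rat_reduce (fps_nth F n))"

definition fps_algebraic :: "'a::field fps \<Rightarrow> bool" where
  "fps_algebraic F \<longleftrightarrow>
     (\<exists>P :: 'a poly poly. P \<noteq> 0 \<and> poly (map_poly fps_of_poly P) F = 0)"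

abbreviation fps_transcendental :: "'a::field fps \<Rightarrow> bool" where
  "fps_transcendental F \<equiv> \<not> fps_algebraic F"

end

theory Submission
  imports "HOL-Algebra.Algebraic_Closure_Type" Defs
begin

text \<open>
  Write E for the reduced series and suppose that it is algebraic. Then so is E(cx) for every c
  in the algebraic closure k of the prime field. A Teichmueller lift z = z^p in the p-adic
  integers satisfies E(cx) = E(x)^z, where c is the residue of z; more generally, a product of
  such scalings over a Frobenius-stable set of scalars c is a power of E whose exponent z is the
  sum of the Teichmueller lifts, and the scalars can be chosen such that z is an irrational
  p-adic integer. Being algebraic over k(x), the series E and E^z satisfy a nontrivial polynomial
  relation over k, that is, a linear relation between the powers E^(i + jz), whose exponents are
  pairwise distinct. Modulo a large power q of p the exponents are still distinct, and a power
  with exponent divisible by q is a series in x^q. Since E = 1 + x + ..., the powers E^r with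
  r < q are linearly independent over the series in x^q (compare orders of vanishing of the
  powers of E - 1), a contradiction.
\<close>

section \<open>Series supported on multiples of q\<close>

text \<open>No p-adic number is constructed: an exponent z is present only as a sequence of natural
  numbers \<open>t i\<close> with \<open>t (Suc i)\<close> congruent to \<open>t i\<close> modulo
  \<open>p ^ Suc i\<close>. Nor is an exact Teichmueller lift needed. In characteristic 0, E(cx) is
  the exponential of the sum of c^(p^i) x^(p^i) / p^i for every c, so a product of scalings depends
  only on the sums of the c^(p^i), and these converge p-adically to the sum of the lifts. Hence the
  integer 2, or the roots of an integer cubic, can replace the lifts, and the product formula is an
  exact identity over the algebraic closure of the rationals; a power of E with exponent z appears
  only after reduction modulo p. The obstacle is that reduction acts on rational coefficients only.
  For the scalar 2 all coefficients are rational; for the cubic the product over the roots is first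
  rewritten as a norm. The scalar 2 works for p > 3, because its residue is then neither 1 nor -1
  and its lift is an irrational root of unity. The relation between E and its power comes from a
  dimension count instead of a theory of transcendence degrees.\<close>

definition fps_sparse :: "nat \<Rightarrow> 'a::comm_ring_1 fps \<Rightarrow> bool" where
  "fps_sparse q F \<longleftrightarrow> (\<forall>n. fps_nth F n \<noteq> 0 \<longrightarrow> q dvd n)"

lemma fps_sparse_mult:
  assumes "fps_sparse q F" "fps_sparse q G"
  shows "fps_sparse q (F * G)"
  unfolding fps_sparse_def
proof (intro allI impI)
  fix n assume "fps_nth (F * G) n \<noteq> 0"
  then obtain i where i: "i \<le> n" "fps_nth F i * fps_nth G (n - i) \<noteq> 0"
    unfolding fps_mult_nth by (meson atLeastAtMost_iff sum.not_neutral_contains_not_neutral)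
  then have "fps_nth F i \<noteq> 0" "fps_nth G (n - i) \<noteq> 0" by auto
  then have "q dvd i" "q dvd n - i"
    using assms unfolding fps_sparse_def by blast+
  with i(1) show "q dvd n" using dvd_add[of q i "n - i"] by simp
qed

lemma fps_sparse_const [simp]: "fps_sparse q (fps_const c)"
  by (simp add: fps_sparse_def)

lemma fps_sparse_of_nat [simp]: "fps_sparse q (of_nat n)"
  by (simp flip: fps_of_nat)

lemma fps_sparse_power: "fps_sparse q F \<Longrightarrow> fps_sparse q (F ^ n)"
  by (induction n) (use fps_sparse_const[of q 1] in \<open>auto intro: fps_sparse_mult\<close>)

lemma fps_sparse_sum: "(\<And>i. i \<in> I \<Longrightarrow> fps_sparse q (F i)) \<Longrightarrow> fps_sparse q (sum F I)"
  unfolding fps_sparse_def fps_sum_nth by (metis sum.not_neutral_contains_not_neutral)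

text \<open>The nonzero summands have pairwise distinct subdegrees, being distinct modulo
  \<open>q\<close>, so the lowest term of the summand of least subdegree cannot cancel.\<close>

lemma sum_distinct_subdegrees_eq_0:
  fixes f :: "nat \<Rightarrow> 'a::comm_ring_1 fps"
  assumes mod: "\<And>s. s < q \<Longrightarrow> f s \<noteq> 0 \<Longrightarrow> subdegree (f s) mod q = s"
    and sum: "(\<Sum>s<q. f s) = 0" and "s < q"
  shows "f s = 0"
proof (rule ccontr)
  assume "f s \<noteq> 0"
  define S where "S = {s. s < q \<and> f s \<noteq> 0}"
  have "S \<noteq> {}" "finite S" using \<open>f s \<noteq> 0\<close> \<open>s < q\<close> by (auto simp: S_def)
  then obtain s' where s': "s' \<in> S" "\<And>s. s \<in> S \<Longrightarrow> subdegree (f s') \<le> subdegree (f s)"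
    using arg_min_if_finite(1)[of S "\<lambda>s. subdegree (f s)"]
      arg_min_least[of S _ "\<lambda>s. subdegree (f s)"] by blast
  define n where "n = subdegree (f s')"
  have "fps_nth (f s) n = 0" if "s < q" "s \<noteq> s'" for s
  proof (cases "f s = 0")
    case False
    have "n \<le> subdegree (f s)"
      using s'(2)[of s] that False by (simp add: n_def S_def)
    moreover have "n \<noteq> subdegree (f s)"
      using mod[of s] mod[of s'] that False s'(1) by (auto simp: n_def S_def)
    ultimately have "n < subdegree (f s)" by simp
    then show ?thesis by (rule nth_less_subdegree_zero)
  qed auto
  then have "fps_nth (\<Sum>s<q. f s) n = (\<Sum>s<q. if s = s' then fps_nth (f s') n else 0)"
    unfolding fps_sum_nth by (intro sum.cong) auto
  also have "\<dots> = fps_nth (f s') n" using s'(1) by (simp add: S_def)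
  also have "\<dots> \<noteq> 0" using s'(1) by (simp add: S_def n_def)
  finally show False using sum by simp
qed

text \<open>The change from powers of \<open>F\<close> to powers of \<open>F - 1\<close> is
  unitriangular with binomial coefficients, so it is valid in every characteristic, and it keeps the
  coefficients sparse.\<close>

lemma powers_independent_over_sparse:
  fixes F :: "'a::field fps"
  assumes F: "fps_nth F 0 = 1" "fps_nth F 1 \<noteq> 0"
    and v: "\<And>r. r < q \<Longrightarrow> fps_sparse q (v r)" and sum: "(\<Sum>r<q. v r * F ^ r) = 0" and "r < q"
  shows "v r = 0"
proof -
  define z where "z = F - 1"
  have z: "subdegree z = 1" "z \<noteq> 0"
    using F by (auto intro!: subdegreeI simp: z_def)
  define w where "w s = (\<Sum>r<q. of_nat (r choose s) * v r)" for s
  have w_sparse: "fps_sparse q (w s)" for s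
    unfolding w_def by (intro fps_sparse_sum fps_sparse_mult v) auto
  have "(\<Sum>r<q. v r * F ^ r) = (\<Sum>r<q. \<Sum>s<q. of_nat (r choose s) * v r * z ^ s)"
  proof (rule sum.cong)
    fix r assume "r \<in> {..<q}"
    have "F ^ r = (z + 1) ^ r" by (simp add: z_def)
    also have "\<dots> = (\<Sum>s\<le>r. of_nat (r choose s) * z ^ s)"
      by (subst binomial_ring) simp
    also have "\<dots> = (\<Sum>s<q. of_nat (r choose s) * z ^ s)"
      using \<open>r \<in> {..<q}\<close> by (intro sum.mono_neutral_left) (auto simp: binomial_eq_0)
    finally show "v r * F ^ r = (\<Sum>s<q. of_nat (r choose s) * v r * z ^ s)"
      by (simp add: sum_distrib_left mult_ac)
  qed simp
  also have "\<dots> = (\<Sum>s<q. w s * z ^ s)"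
    by (subst sum.swap) (simp add: w_def sum_distrib_right)
  finally have sum_w: "(\<Sum>s<q. w s * z ^ s) = 0" using sum by simp
  have w0: "w s = 0" if "s < q" for s
  proof -
    have "w s * z ^ s = 0"
    proof (rule sum_distinct_subdegrees_eq_0[OF _ sum_w that])
      fix s assume s: "s < q" "w s * z ^ s \<noteq> 0"
      then have "w s \<noteq> 0" by auto
      then have "q dvd subdegree (w s)"
        using w_sparse[of s] unfolding fps_sparse_def by auto
      then show "subdegree (w s * z ^ s) mod q = s"
        using s \<open>w s \<noteq> 0\<close> z by (auto simp: elim!: dvdE)
    qed
    with z show ?thesis by simp
  qed
  \<comment> \<open>The triangular system \<open>w = 0\<close> is solved from the top: in
    \<open>w r\<close> the indices below \<open>r\<close> have binomial coefficient 0, and those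
    above it vanish by induction.\<close>
  show ?thesis using \<open>r < q\<close>
  proof (induction "q - r" arbitrary: r rule: less_induct)
    case less
    have "w r = (\<Sum>i<q. if i = r then v r else 0)"
      unfolding w_def
    proof (rule sum.cong)
      fix i assume "i \<in> {..<q}"
      then show "of_nat (i choose r) * v i = (if i = r then v r else 0)"
        using less by (cases i r rule: linorder_cases) (auto simp: binomial_eq_0)
    qed simp
    with w0 less show ?case by simp
  qed
qed

text \<open>This is the form in which independence is applied. Injectivity of \<open>r\<close>
  prevents two terms from merging into one sparse coefficient, where they might cancel.\<close>

lemma twisted_powers_independent:
  fixes F :: "'a::field fps"
  assumes F: "fps_nth F 0 = 1" "fps_nth F 1 \<noteq> 0"
    and "finite I" and inj: "inj_on r I" and r: "\<And>i. i \<in> I \<Longrightarrow> r i < q"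
    and u: "\<And>i. i \<in> I \<Longrightarrow> fps_sparse q (u i)" "\<And>i. i \<in> I \<Longrightarrow> u i \<noteq> 0"
    and sum: "(\<Sum>i\<in>I. fps_const (c i) * (F ^ r i * u i)) = 0" and i: "i \<in> I"
  shows "c i = 0"
proof -
  define v where "v s = (\<Sum>i\<in>{i\<in>I. r i = s}. fps_const (c i) * u i)" for s
  have v_r: "v (r i) = fps_const (c i) * u i" if "i \<in> I" for i
  proof -
    have "{j\<in>I. r j = r i} = {i}" using inj that by (auto simp: inj_on_def)
    then show ?thesis by (simp add: v_def)
  qed
  have "(\<Sum>s<q. v s * F ^ s) = (\<Sum>s<q. \<Sum>i\<in>{i\<in>I. r i = s}. fps_const (c i) * (F ^ r i * u i))"
    by (simp add: v_def sum_distrib_left sum_distrib_right mult_ac)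
  also have "\<dots> = (\<Sum>i\<in>I. fps_const (c i) * (F ^ r i * u i))"
    using r \<open>finite I\<close> by (intro sum.group) auto
  finally have sum_v: "(\<Sum>s<q. v s * F ^ s) = 0" using sum by simp
  have "fps_sparse q (v s)" for s
    unfolding v_def by (intro fps_sparse_sum fps_sparse_mult) (auto intro: u)
  then have "v (r i) = 0"
    by (rule powers_independent_over_sparse[OF F _ sum_v r[OF i]])
  with v_r[OF i] u(2)[OF i] show ?thesis by simp
qed

section \<open>Dimension growth of algebraic series\<close>

interpretation fps_vs: vector_space "\<lambda>c (f :: 'a::field fps). fps_const c * f"
  by unfold_locales (auto simp: algebra_simps simp flip: fps_const_add fps_const_mult)

text \<open>The span is taken over the constants, not over the polynomials: for finite
  \<open>B\<close> its dimension is at most \<open>(D + 1) * card B\<close>, and this number is what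
  gets compared with a number of monomials.\<close>

definition poly_span :: "'a::field fps set \<Rightarrow> nat \<Rightarrow> 'a fps set" where
  "poly_span B D = fps_vs.span ((\<lambda>(a, b). fps_X ^ a * b) ` ({..D} \<times> B))"

lemma poly_span_mono: "D \<le> D' \<Longrightarrow> B \<subseteq> B' \<Longrightarrow> poly_span B D \<subseteq> poly_span B' D'"
  unfolding poly_span_def by (intro fps_vs.span_mono image_mono) auto

lemma poly_span_sum: "(\<And>i. i \<in> I \<Longrightarrow> f i \<in> poly_span B D) \<Longrightarrow> sum f I \<in> poly_span B D"
  unfolding poly_span_def by (rule fps_vs.span_sum)

lemma poly_span_uminus: "f \<in> poly_span B D \<Longrightarrow> - f \<in> poly_span B D"
  unfolding poly_span_def by (rule fps_vs.span_neg)

lemma mult_poly_spanI: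
  assumes gen: "\<And>a b. a \<le> D \<Longrightarrow> b \<in> B \<Longrightarrow> g * (fps_X ^ a * b) \<in> poly_span B' D'"
    and f: "f \<in> poly_span B D"
  shows "g * f \<in> poly_span B' D'"
  using f unfolding poly_span_def
proof (induction rule: fps_vs.span_induct_alt)
  case base
  show ?case using fps_vs.span_zero by simp
next
  case (step c x y)
  then have "g * x \<in> poly_span B' D'" using gen by auto
  then have "fps_const c * (g * x) + g * y \<in> poly_span B' D'"
    using step unfolding poly_span_def by (intro fps_vs.span_add fps_vs.span_scale)
  then show ?case by (simp add: poly_span_def algebra_simps)
qed

lemma poly_span_base: "b \<in> B \<Longrightarrow> a \<le> D \<Longrightarrow> fps_X ^ a * b \<in> poly_span B D"
  unfolding poly_span_def by (intro fps_vs.span_base) force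

lemma poly_span_base': "b \<in> B \<Longrightarrow> b \<in> poly_span B D"
  using poly_span_base[of b B 0 D] by simp

lemma fps_X_power_mult_poly_span:
  assumes "f \<in> poly_span B D"
  shows "fps_X ^ n * f \<in> poly_span B (D + n)"
proof (rule mult_poly_spanI[OF _ assms])
  fix a b assume "a \<le> D" "b \<in> B"
  then show "fps_X ^ n * (fps_X ^ a * b) \<in> poly_span B (D + n)"
    using poly_span_base[of b B "n + a" "D + n"] by (simp add: power_add mult.assoc)
qed

lemma fps_of_poly_mult_poly_span:
  assumes "f \<in> poly_span B D" "Polynomial.degree c \<le> n"
  shows "fps_of_poly c * f \<in> poly_span B (D + n)"
proof -
  have "fps_of_poly c = (\<Sum>i\<le>Polynomial.degree c. fps_const (Polynomial.coeff c i) * fps_X ^ i)"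
    by (subst poly_as_sum_of_monoms[of c, symmetric])
       (simp only: fps_of_poly_sum fps_of_poly_monom)
  then have eq: "fps_of_poly c * f = (\<Sum>i\<le>Polynomial.degree c. fps_const (Polynomial.coeff c i) * (fps_X ^ i * f))"
    by (simp add: sum_distrib_left sum_distrib_right mult_ac)
  show ?thesis unfolding eq
  proof (rule poly_span_sum)
    fix i assume "i \<in> {..Polynomial.degree c}"
    then have "fps_X ^ i * f \<in> poly_span B (D + n)"
      using fps_X_power_mult_poly_span[OF assms(1), of i] assms(2)
        poly_span_mono[of "D + i" "D + n" B B] by auto
    then show "fps_const (Polynomial.coeff c i) * (fps_X ^ i * f) \<in> poly_span B (D + n)"
      unfolding poly_span_def by (rule fps_vs.span_scale)
  qed
qed

text \<open>\<open>a\<close> plays the part of a common denominator, and \<open>C\<close> bounds the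
  growth of degrees. Along products these bounds simply add up.\<close>

definition bounded_mult :: "'a::field poly \<Rightarrow> nat \<Rightarrow> 'a fps set \<Rightarrow> 'a fps \<Rightarrow> bool" where
  "bounded_mult a C B f \<longleftrightarrow> (\<forall>b\<in>B. fps_of_poly a * f * b \<in> poly_span B C)"

lemma bounded_mult_poly_span:
  assumes "bounded_mult a C B f" "v \<in> poly_span B D"
  shows "fps_of_poly a * f * v \<in> poly_span B (C + D)"
proof (rule mult_poly_spanI[OF _ assms(2)])
  fix i b assume "i \<le> D" "b \<in> B"
  then have "fps_X ^ i * (fps_of_poly a * f * b) \<in> poly_span B (C + i)"
    using assms(1) unfolding bounded_mult_def by (intro fps_X_power_mult_poly_span) auto
  then show "fps_of_poly a * f * (fps_X ^ i * b) \<in> poly_span B (C + D)"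
    using poly_span_mono[of "C + i" "C + D" B B] \<open>i \<le> D\<close> by (auto simp: mult_ac)
qed

lemma bounded_mult_prod_list:
  assumes "\<And>f. f \<in> set L \<Longrightarrow> bounded_mult a C B f" "1 \<in> B"
  shows "fps_of_poly a ^ length L * prod_list L \<in> poly_span B (length L * C)"
  using assms(1)
proof (induction L)
  case Nil
  then show ?case using poly_span_base'[OF assms(2)] by simp
next
  case (Cons f L)
  then have "fps_of_poly a * f * (fps_of_poly a ^ length L * prod_list L)
               \<in> poly_span B (C + length L * C)"
    by (intro bounded_mult_poly_span) auto
  then show ?case by (simp add: mult_ac)
qed

lemma fps_of_poly_eq_0_iff [simp]: "fps_of_poly p = 0 \<longleftrightarrow> p = 0"
  using fps_of_poly_eq_iff[of p 0] by simp

text \<open>For a new \<open>f\<close> with an equation of degree \<open>d\<close>, the generators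
  are multiplied by \<open>f ^ i\<close> for \<open>i < d\<close>; the leading coefficient joins the
  denominator, so that the equation can rewrite \<open>f ^ d\<close> by lower powers.\<close>

lemma algebraic_imp_bounded_mult:
  fixes fs :: "'a::field fps list"
  assumes "\<And>f. f \<in> set fs \<Longrightarrow> fps_algebraic f"
  shows "\<exists>a C B. a \<noteq> 0 \<and> finite B \<and> 1 \<in> B \<and> (\<forall>f\<in>set fs. bounded_mult a C B f)"
  using assms
proof (induction fs)
  case Nil
  then show ?case by (intro exI[of _ 1] exI[of _ 0] exI[of _ "{1}"]) auto
next
  case (Cons f fs)
  have "\<exists>a C B. a \<noteq> 0 \<and> finite B \<and> 1 \<in> B \<and> (\<forall>f\<in>set fs. bounded_mult a C B f)"
    by (rule Cons.IH) (rule Cons.prems, simp)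
  then obtain a C B where IH: "a \<noteq> 0" "finite B" "1 \<in> B"
      "\<And>g. g \<in> set fs \<Longrightarrow> bounded_mult a C B g"
    by blast
  obtain P where P: "P \<noteq> 0" "poly (map_poly fps_of_poly P) f = 0"
    using Cons.prems[of f, OF list.set_intros(1)] unfolding fps_algebraic_def by (elim exE conjE)
  define d where "d = Polynomial.degree P"
  define c where "c i = fps_of_poly (Polynomial.coeff P i)" for i
  have "Polynomial.degree (map_poly fps_of_poly P) = d"
    unfolding d_def by (rule degree_map_poly) (simp add: P(1))
  then have sum: "(\<Sum>i\<le>d. c i * f ^ i) = 0"
    using P(2) by (simp add: poly_altdef coeff_map_poly c_def)
  \<comment> \<open>This keeps \<open>1\<close> among the new generators.\<close>
  have "d > 0"
  proof (rule ccontr)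
    assume "\<not> d > 0"
    then have "fps_of_poly (Polynomial.coeff P (Polynomial.degree P)) = 0"
      using sum by (simp add: c_def d_def)
    with P(1) show False by simp
  qed
  define D where "D = Max ((\<lambda>i. Polynomial.degree (Polynomial.coeff P i)) ` {..d})"
  have D: "Polynomial.degree (Polynomial.coeff P i) \<le> D" if "i \<le> d" for i
    unfolding D_def using that by (intro Max_ge) auto
  define B' where "B' = (\<lambda>(b, i). b * f ^ i) ` (B \<times> {..<d})"
  have B': "b * f ^ i \<in> B'" if "b \<in> B" "i < d" for b i
    unfolding B'_def using that by force
  define C' where "C' = C + D + Polynomial.degree a"
  have old: "bounded_mult (a * Polynomial.coeff P d) C' B' g" if g: "g \<in> set fs" for g
    unfolding bounded_mult_def
  proof
    fix x assume "x \<in> B'"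
    then obtain b i where x: "x = b * f ^ i" "b \<in> B" "i < d" by (auto simp: B'_def)
    have "f ^ i * (fps_of_poly a * g * b) \<in> poly_span B' C"
    proof (rule mult_poly_spanI)
      show "fps_of_poly a * g * b \<in> poly_span B C"
        using IH(4)[OF g] x by (auto simp: bounded_mult_def)
      fix n y assume "n \<le> C" "y \<in> B"
      then show "f ^ i * (fps_X ^ n * y) \<in> poly_span B' C"
        using poly_span_base[OF B'[of y i], of n C] x by (simp add: mult_ac)
    qed
    then have "c d * (f ^ i * (fps_of_poly a * g * b)) \<in> poly_span B' (C + D)"
      unfolding c_def by (rule fps_of_poly_mult_poly_span) (simp add: D)
    also have "\<dots> \<subseteq> poly_span B' C'" by (rule poly_span_mono) (auto simp: C'_def)
    finally show "fps_of_poly (a * Polynomial.coeff P d) * g * x \<in> poly_span B' C'"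
      by (simp add: fps_of_poly_mult c_def x mult_ac)
  qed
  have new: "bounded_mult (a * Polynomial.coeff P d) C' B' f"
    unfolding bounded_mult_def
  proof
    fix x assume "x \<in> B'"
    then obtain b i where x: "x = b * f ^ i" "b \<in> B" "i < d" by (auto simp: B'_def)
    have "c d * (b * f ^ Suc i) \<in> poly_span B' D"
    proof (cases "Suc i < d")
      case True
      then have "c d * (b * f ^ Suc i) \<in> poly_span B' (0 + D)"
        unfolding c_def by (intro fps_of_poly_mult_poly_span poly_span_base' B' x) (auto simp: D)
      then show ?thesis by simp
    next
      case False
      with x have d: "d = Suc i" by simp
      have "c d * (b * f ^ Suc i) = - (\<Sum>i<d. c i * (b * f ^ i))"
        using arg_cong[OF sum, of "\<lambda>y. b * y"] unfolding d lessThan_Suc_atMost[symmetric]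
        by (simp add: algebra_simps sum_distrib_left eq_neg_iff_add_eq_0)
      also have "\<dots> \<in> poly_span B' (0 + D)"
        unfolding c_def
        by (intro poly_span_uminus poly_span_sum fps_of_poly_mult_poly_span poly_span_base' B' x)
           (auto simp: D)
      finally show ?thesis by simp
    qed
    then have "fps_of_poly a * (c d * (b * f ^ Suc i)) \<in> poly_span B' (D + Polynomial.degree a)"
      by (rule fps_of_poly_mult_poly_span) simp
    also have "\<dots> \<subseteq> poly_span B' C'" by (rule poly_span_mono) (auto simp: C'_def)
    finally show "fps_of_poly (a * Polynomial.coeff P d) * f * x \<in> poly_span B' C'"
      by (simp add: fps_of_poly_mult c_def x mult_ac)
  qed
  show ?case
  proof (intro exI conjI ballI)
    show "a * Polynomial.coeff P d \<noteq> 0" using IH(1) P(1) by (simp add: d_def)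
    show "finite B'" unfolding B'_def using IH(2) by auto
    show "1 \<in> B'" using B'[OF IH(3) \<open>d > 0\<close>] by simp
    show "bounded_mult (a * Polynomial.coeff P d) C' B' g" if "g \<in> set (f # fs)" for g
      using that old new by auto
  qed
qed

text \<open>Multiplied by one fixed power of the denominator, the \<open>(m + 1) * (m + 1)\<close>
  monomials lie in a space whose dimension grows only linearly in \<open>m\<close>.\<close>

lemma algebraic_imp_monomials_dependent:
  fixes F :: "'a::field fps"
  assumes alg: "fps_algebraic F" "\<And>f. f \<in> set L \<Longrightarrow> fps_algebraic f"
  shows "\<exists>m c. (\<Sum>(i,j)\<in>{..m}\<times>{..m}. fps_const (c (i, j)) * (F ^ i * prod_list L ^ j)) = 0 \<and>
           (\<exists>i\<le>m. \<exists>j\<le>m. c (i, j) \<noteq> 0)"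
proof (rule ccontr)
  define G where "G = prod_list L"
  assume notex: "\<not> ?thesis"
  have indep: "c (i, j) = 0" if
    "(\<Sum>(i,j)\<in>{..m}\<times>{..m}. fps_const (c (i, j)) * (F ^ i * G ^ j)) = 0" "i \<le> m" "j \<le> m"
    for m c i j
  proof (rule ccontr)
    assume "c (i, j) \<noteq> 0"
    with that(2,3) have "\<exists>i\<le>m. \<exists>j\<le>m. c (i, j) \<noteq> 0" by auto
    with that(1) show False
      using notex[unfolded not_ex, THEN spec, THEN spec, of c m] unfolding G_def by (simp only: simp_thms)
  qed
  obtain a C B where B: "a \<noteq> 0" "finite B" "1 \<in> B" "\<And>f. f \<in> set (F # L) \<Longrightarrow> bounded_mult a C B f"
  proof -
    have "fps_algebraic f" if "f \<in> set (F # L)" for f using alg that by auto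
    from algebraic_imp_bounded_mult[OF this] show ?thesis using that by blast
  qed
  \<comment> \<open>\<open>N * m\<close> bounds the number of factors of a monomial, and
    \<open>K * m\<close> the degree once each of the \<open>N * m\<close> places is charged with
    \<open>C\<close> and with the degree of \<open>a\<close>. The choice of \<open>m\<close> yields
    \<open>(K * m + 1) * card B \<le> (m + 1) * m\<close>.\<close>
  define N where "N = Suc (length L)"
  define K where "K = N * (C + Polynomial.degree a)"
  define m where "m = Suc K * card B"
  define A where "A = fps_of_poly a ^ (N * m)"
  have "A \<noteq> 0"
    unfolding A_def using B(1) by simp
  define T where "T = (\<lambda>(a, b). fps_X ^ a * b) ` ({..K * m} \<times> B)"
  define h where "h = (\<lambda>(i, j). A * (F ^ i * G ^ j))"
  have span: "h (i, j) \<in> fps_vs.span T" if ij: "i \<le> m" "j \<le> m" for i j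
  proof -
    define L' where "L' = replicate i F @ concat (replicate j L)"
    have prod: "prod_list L' = F ^ i * G ^ j"
    proof -
      have "prod_list (concat (replicate j L)) = G ^ j"
        by (induction j) (auto simp: G_def)
      then show ?thesis by (simp add: L'_def)
    qed
    have len: "length L' = i + j * length L"
      by (simp add: L'_def length_concat sum_list_replicate)
    also have "\<dots> \<le> m + m * length L" using ij by (intro add_mono mult_mono) auto
    finally have len': "length L' \<le> N * m" by (simp add: N_def mult.commute)
    have sub: "set L' \<subseteq> set (F # L)" by (auto simp: L'_def)
    have "fps_of_poly a ^ length L' * prod_list L' \<in> poly_span B (length L' * C)"
      using sub B by (intro bounded_mult_prod_list) auto
    \<comment> \<open>Monomials with fewer factors are padded with powers of \<open>a\<close>, so
      that all share the multiplier \<open>A\<close>.\<close>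
    then have "fps_of_poly (a ^ (N * m - length L')) * (fps_of_poly a ^ length L' * prod_list L')
        \<in> poly_span B (length L' * C + (N * m - length L') * Polynomial.degree a)"
      by (rule fps_of_poly_mult_poly_span) (metis degree_power_le mult.commute)
    also have "\<dots> \<subseteq> poly_span B (K * m)"
    proof (rule poly_span_mono)
      have "length L' * C + (N * m - length L') * Polynomial.degree a \<le> (N * m) * C + (N * m) * Polynomial.degree a"
        using len' by (intro add_mono mult_mono) auto
      then show "length L' * C + (N * m - length L') * Polynomial.degree a \<le> K * m"
        by (simp add: K_def algebra_simps)
    qed simp
    also have "fps_of_poly (a ^ (N * m - length L')) * (fps_of_poly a ^ length L' * prod_list L')
       = h (i, j)"
      using len' by (simp add: fps_of_poly_power A_def h_def prod mult.assoc[symmetric] flip: power_add)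
    finally show ?thesis by (simp add: poly_span_def T_def)
  qed
  have h_sum: "(\<Sum>x\<in>{..m}\<times>{..m}. fps_const (c x) * h x) = 0 \<Longrightarrow> x \<in> {..m}\<times>{..m} \<Longrightarrow> c x = 0" for c x
  proof -
    assume "(\<Sum>x\<in>{..m}\<times>{..m}. fps_const (c x) * h x) = 0" and x: "x \<in> {..m}\<times>{..m}"
    moreover have "(\<Sum>x\<in>{..m}\<times>{..m}. fps_const (c x) * h x) =
        A * (\<Sum>(i,j)\<in>{..m}\<times>{..m}. fps_const (c (i, j)) * (F ^ i * G ^ j))"
      unfolding sum_distrib_left by (intro sum.cong) (auto simp: h_def mult_ac)
    ultimately have "(\<Sum>(i,j)\<in>{..m}\<times>{..m}. fps_const (c (i, j)) * (F ^ i * G ^ j)) = 0"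
      using \<open>A \<noteq> 0\<close> by simp
    with x show "c x = 0" using indep by (cases x) auto
  qed
  \<comment> \<open>Independence is a property of a set, so coinciding monomials would spoil the
    count; the coefficients 1 and -1 turn a coincidence into a relation.\<close>
  have inj: "inj_on h ({..m}\<times>{..m})"
  proof (rule inj_onI, rule ccontr)
    fix x y assume xy: "x \<in> {..m}\<times>{..m}" "y \<in> {..m}\<times>{..m}" "h x = h y" "x \<noteq> y"
    let ?c = "\<lambda>z. if z = x then 1 else if z = y then -1 else (0::'a)"
    have "(\<Sum>z\<in>{..m}\<times>{..m}. fps_const (?c z) * h z) = (\<Sum>z\<in>{x, y}. fps_const (?c z) * h z)"
      using xy by (intro sum.mono_neutral_right) auto
    also have "\<dots> = 0" using xy by (simp flip: fps_const_neg)
    finally show False using h_sum[of ?c x] xy by simp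
  qed
  have "fps_vs.independent (h ` ({..m}\<times>{..m}))"
  proof (rule fps_vs.independent_if_scalars_zero)
    fix f x assume sum: "(\<Sum>x\<in>h ` ({..m}\<times>{..m}). fps_const (f x) * x) = 0"
      and "x \<in> h ` ({..m}\<times>{..m})"
    then obtain y where y: "x = h y" "y \<in> {..m}\<times>{..m}" by auto
    have "(\<Sum>y\<in>{..m}\<times>{..m}. fps_const (f (h y)) * h y) = 0"
      using sum by (subst (asm) sum.reindex[OF inj]) simp
    then show "f x = 0" using h_sum[of "\<lambda>y. f (h y)" y] y by simp
  qed auto
  moreover have "h ` ({..m}\<times>{..m}) \<subseteq> fps_vs.span T" using span by auto
  moreover have "finite T" using B by (auto simp: T_def)
  ultimately have "card (h ` ({..m}\<times>{..m})) \<le> card T"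
    using fps_vs.independent_span_bound by blast
  then have "(m + 1) * (m + 1) \<le> card T"
    using inj by (simp add: card_image card_cartesian_product)
  also have "card T \<le> card ({..K * m} \<times> B)" unfolding T_def
    by (rule card_image_le) (use B in auto)
  also have "\<dots> = (K * m + 1) * card B" by (simp add: card_cartesian_product)
  also have "\<dots> \<le> (Suc K * (m + 1)) * card B" by (intro mult_right_mono) auto
  also have "\<dots> = (m + 1) * m" by (simp add: m_def algebra_simps)
  finally show False by simp
qed

section \<open>Reduction modulo p\<close>

text \<open>The fraction need not be in lowest terms, which keeps the closure proofs free of gcd
  computations.\<close>

definition p_integral :: "nat \<Rightarrow> rat \<Rightarrow> bool" where
  "p_integral p r \<longleftrightarrow> (\<exists>a b. r = of_int a / of_int b \<and> \<not> int p dvd b)"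

lemma p_integralE:
  assumes "p_integral p r"
  obtains a b where "r = of_int a / of_int b" "\<not> int p dvd b" "b \<noteq> 0"
  using assms unfolding p_integral_def by (metis dvd_0_right)

lemma p_integral_of_int [simp]: "prime p \<Longrightarrow> p_integral p (of_int a)"
  unfolding p_integral_def
  by (intro exI[of _ a] exI[of _ 1]) (auto dest: not_prime_unit simp: zdvd1_eq)

lemma p_integral_of_nat [simp]: "prime p \<Longrightarrow> p_integral p (of_nat a)"
  using p_integral_of_int[of p "int a"] by simp

lemma p_integral_0 [simp]: "prime p \<Longrightarrow> p_integral p 0"
  and p_integral_1 [simp]: "prime p \<Longrightarrow> p_integral p 1"
  using p_integral_of_nat[of p 0] p_integral_of_nat[of p 1] by simp_all

lemma p_integral_add:
  assumes "prime p" "p_integral p r" "p_integral p s"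
  shows "p_integral p (r + s)"
proof -
  obtain a b where r: "r = of_int a / of_int b" "\<not> int p dvd b" "b \<noteq> 0"
    using assms(2) by (rule p_integralE)
  obtain c d where s: "s = of_int c / of_int d" "\<not> int p dvd d" "d \<noteq> 0"
    using assms(3) by (rule p_integralE)
  have "r + s = of_int (a * d + c * b) / of_int (b * d)"
    using r s by (simp add: field_simps)
  moreover have "\<not> int p dvd b * d"
    using r s assms(1) by (simp add: prime_dvd_mult_iff)
  ultimately show ?thesis unfolding p_integral_def by blast
qed

lemma p_integral_mult:
  assumes "prime p" "p_integral p r" "p_integral p s"
  shows "p_integral p (r * s)"
proof -
  obtain a b where r: "r = of_int a / of_int b" "\<not> int p dvd b" "b \<noteq> 0"
    using assms(2) by (rule p_integralE)
  obtain c d where s: "s = of_int c / of_int d" "\<not> int p dvd d" "d \<noteq> 0"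
    using assms(3) by (rule p_integralE)
  have "r * s = of_int (a * c) / of_int (b * d)"
    using r s by simp
  moreover have "\<not> int p dvd b * d"
    using r s assms(1) by (simp add: prime_dvd_mult_iff)
  ultimately show ?thesis unfolding p_integral_def by blast
qed

lemma p_integral_diff:
  assumes "prime p" "p_integral p r" "p_integral p s"
  shows "p_integral p (r - s)"
  using p_integral_add[OF assms(1,2) p_integral_mult[OF assms(1) p_integral_of_int[OF assms(1), of "-1"] assms(3)]]
  by simp

lemma p_integral_sum:
  assumes "prime p" "\<And>i. i \<in> I \<Longrightarrow> p_integral p (f i)"
  shows "p_integral p (sum f I)"
  using assms(2) by (induction I rule: infinite_finite_induct) (auto simp: assms(1) p_integral_add)

lemma rat_reduce_of_int [simp]: "(rat_reduce (of_int a) :: 'p::prime_card mod_ring) = of_int a"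
proof -
  have "\<not> int CARD('p) dvd 1" using prime_card_int[where 'a = 'p] not_prime_unit by blast
  from rat_reduce_divide[OF this, of a] show ?thesis by simp
qed

lemma rat_reduce_0 [simp]: "rat_reduce 0 = 0" and rat_reduce_1 [simp]: "rat_reduce 1 = 1"
  using rat_reduce_of_int[of 0] rat_reduce_of_int[of 1] by simp_all

lemma rat_reduce_add:
  fixes r s :: rat
  assumes "p_integral CARD('p::prime_card) r" "p_integral CARD('p) s"
  shows "(rat_reduce (r + s) :: 'p mod_ring) = rat_reduce r + rat_reduce s"
proof -
  obtain a b where r: "r = of_int a / of_int b" "\<not> int CARD('p) dvd b" "b \<noteq> 0"
    using assms(1) by (rule p_integralE)
  obtain c d where s: "s = of_int c / of_int d" "\<not> int CARD('p) dvd d" "d \<noteq> 0"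
    using assms(2) by (rule p_integralE)
  have "r + s = of_int (a * d + c * b) / of_int (b * d)"
    using r s by (simp add: field_simps)
  moreover have "\<not> int CARD('p) dvd b * d"
    using r s prime_dvd_mult_iff[OF prime_card_int[where 'a = 'p], of b d] by blast
  ultimately have "(rat_reduce (r + s) :: 'p mod_ring) = of_int (a * d + c * b) / of_int (b * d)"
    by (simp only: rat_reduce_divide not_False_eq_True)
  also have "\<dots> = of_int a / of_int b + of_int c / of_int d"
  proof -
    have "(of_int b :: 'p mod_ring) \<noteq> 0" "(of_int d :: 'p mod_ring) \<noteq> 0"
      using r(2) s(2) by (simp_all add: of_int_mod_ring_eq_0_iff)
    then show ?thesis by (simp add: add_frac_eq)
  qed
  finally show ?thesis using r s by (simp add: rat_reduce_divide)
qed

lemma rat_reduce_mult: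
  fixes r s :: rat
  assumes "p_integral CARD('p::prime_card) r" "p_integral CARD('p) s"
  shows "(rat_reduce (r * s) :: 'p mod_ring) = rat_reduce r * rat_reduce s"
proof -
  obtain a b where r: "r = of_int a / of_int b" "\<not> int CARD('p) dvd b" "b \<noteq> 0"
    using assms(1) by (rule p_integralE)
  obtain c d where s: "s = of_int c / of_int d" "\<not> int CARD('p) dvd d" "d \<noteq> 0"
    using assms(2) by (rule p_integralE)
  have "r * s = of_int (a * c) / of_int (b * d)"
    using r s by simp
  moreover have "\<not> int CARD('p) dvd b * d"
    using r s prime_dvd_mult_iff[OF prime_card_int[where 'a = 'p], of b d] by blast
  ultimately have "(rat_reduce (r * s) :: 'p mod_ring) = of_int (a * c) / of_int (b * d)"
    by (simp only: rat_reduce_divide not_False_eq_True)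
  then show ?thesis using r s by (simp add: rat_reduce_divide)
qed

lemma rat_reduce_sum:
  assumes "\<And>i. i \<in> I \<Longrightarrow> p_integral CARD('p::prime_card) (f i)"
  shows "(rat_reduce (sum f I) :: 'p mod_ring) = (\<Sum>i\<in>I. rat_reduce (f i))"
  using assms
  by (induction I rule: infinite_finite_induct)
     (auto simp: rat_reduce_add p_integral_sum prime_card)

lemma rat_reduce_eq_0_imp_p_integral_divide:
  assumes "p_integral CARD('p::prime_card) r" "(rat_reduce r :: 'p mod_ring) = 0"
  shows "p_integral CARD('p) (r / of_nat CARD('p))"
proof -
  obtain a b where r: "r = of_int a / of_int b" "\<not> int CARD('p) dvd b" "b \<noteq> 0"
    using assms(1) by (rule p_integralE)
  have "(of_int a :: 'p mod_ring) = 0"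
    using assms(2) r by (simp add: rat_reduce_divide of_int_mod_ring_eq_0_iff)
  then have "int CARD('p) dvd a" by (simp add: of_int_mod_ring_eq_0_iff)
  then obtain c where "a = int CARD('p) * c" ..
  then have "r / of_nat CARD('p) = of_int c / of_int b" using r by simp
  with r show ?thesis unfolding p_integral_def by blast
qed

section \<open>Integrality and reduction of power series\<close>

definition p_integral_fps :: "nat \<Rightarrow> rat fps \<Rightarrow> bool" where
  "p_integral_fps p F \<longleftrightarrow> (\<forall>n. p_integral p (fps_nth F n))"

lemma p_integral_fps_1 [simp]: "prime p \<Longrightarrow> p_integral_fps p 1"
  by (simp add: p_integral_fps_def fps_one_def)

lemma p_integral_fps_add:
  "prime p \<Longrightarrow> p_integral_fps p F \<Longrightarrow> p_integral_fps p G \<Longrightarrow> p_integral_fps p (F + G)"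
  by (simp add: p_integral_fps_def p_integral_add)

lemma p_integral_fps_mult:
  "prime p \<Longrightarrow> p_integral_fps p F \<Longrightarrow> p_integral_fps p G \<Longrightarrow> p_integral_fps p (F * G)"
  unfolding p_integral_fps_def fps_mult_nth by (auto intro!: p_integral_sum p_integral_mult)

lemma p_integral_fps_power: "prime p \<Longrightarrow> p_integral_fps p F \<Longrightarrow> p_integral_fps p (F ^ n)"
  by (induction n) (auto intro: p_integral_fps_mult)

lemma fps_reduce_1 [simp]: "fps_reduce 1 = 1"
  by (simp add: fps_eq_iff fps_reduce_def fps_one_def)

lemma fps_reduce_add:
  assumes "p_integral_fps CARD('p::prime_card) F" "p_integral_fps CARD('p) G"
  shows "(fps_reduce (F + G) :: 'p mod_ring fps) = fps_reduce F + fps_reduce G"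
  using assms by (simp add: fps_eq_iff fps_reduce_def rat_reduce_add p_integral_fps_def)

lemma fps_reduce_mult:
  assumes "p_integral_fps CARD('p::prime_card) F" "p_integral_fps CARD('p) G"
  shows "(fps_reduce (F * G) :: 'p mod_ring fps) = fps_reduce F * fps_reduce G"
proof (rule fps_ext)
  fix n
  have "p_integral CARD('p) (fps_nth F i * fps_nth G (n - i))" for i
    using assms prime_card by (auto simp: p_integral_fps_def intro!: p_integral_mult)
  then show "fps_nth (fps_reduce (F * G) :: 'p mod_ring fps) n = fps_nth (fps_reduce F * fps_reduce G) n"
    using assms by (simp add: fps_reduce_def fps_mult_nth rat_reduce_sum rat_reduce_mult p_integral_fps_def)
qed

lemma fps_reduce_power:
  assumes "p_integral_fps CARD('p::prime_card) F"
  shows "(fps_reduce (F ^ n) :: 'p mod_ring fps) = fps_reduce F ^ n"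
  using assms prime_card[where 'a = 'p]
  by (induction n) (auto simp: fps_reduce_mult p_integral_fps_power)

lemma fps_compose_X_power_nth:
  fixes F :: "'a::comm_ring_1 fps"
  assumes "k > 0"
  shows "fps_nth (F oo fps_X ^ k) n = (if k dvd n then fps_nth F (n div k) else 0)"
proof (cases "k dvd n")
  case True
  then obtain m where m: "n = k * m" ..
  have "m \<le> n" using m assms by (cases k) auto
  have "fps_nth (F oo fps_X ^ k) n = (\<Sum>i=0..n. if i = m then fps_nth F m else 0)"
    unfolding fps_compose_nth using assms m
    by (intro sum.cong) (auto simp: fps_X_power_nth simp flip: power_mult)
  with True m assms \<open>m \<le> n\<close> show ?thesis by simp
next
  case False
  then show ?thesis unfolding fps_compose_nth
    by (auto simp: fps_X_power_nth simp flip: power_mult intro!: sum.neutral)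
qed

lemma p_integral_fps_compose_X_power:
  "prime p \<Longrightarrow> k > 0 \<Longrightarrow> p_integral_fps p F \<Longrightarrow> p_integral_fps p (F oo fps_X ^ k)"
  by (simp add: p_integral_fps_def fps_compose_X_power_nth)

lemma fps_reduce_compose_X_power:
  "k > 0 \<Longrightarrow> fps_reduce (F oo fps_X ^ k) = fps_reduce F oo fps_X ^ k"
  by (simp add: fps_eq_iff fps_reduce_def fps_compose_X_power_nth)

section \<open>The Frobenius map on power series\<close>

lemma CHAR_fps: "CHAR('a::semiring_1 fps) = CHAR('a)"
proof (rule CHAR_eqI)
  show "of_nat CHAR('a) = (0 :: 'a fps)"
    by (simp flip: fps_of_nat)
  show "CHAR('a) dvd n" if "of_nat n = (0 :: 'a fps)" for n
    using that by (simp add: of_nat_eq_0_iff_char_dvd flip: fps_of_nat)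
qed

lemma mod_ring_power_card [simp]:
  fixes x :: "'p::prime_card mod_ring"
  shows "x ^ CARD('p) = x"
proof -
  obtain i where i: "x = of_nat i" using surj_of_nat_mod_ring by blast
  have "[i ^ CARD('p) = i] (mod CARD('p))"
  proof (cases "CARD('p) dvd i")
    case True
    moreover have "i dvd i ^ CARD('p)" by (rule dvd_power) simp
    ultimately show ?thesis by (auto simp: cong_def mod_eq_0_iff_dvd intro: dvd_trans)
  next
    case False
    then have "[i ^ (CARD('p) - 1) * i = 1 * i] (mod CARD('p))"
      using fermat_theorem[OF prime_card] by (intro cong_mult) auto
    then show ?thesis using prime_gt_0_nat[OF prime_card[where 'a = 'p]]
      by (simp flip: power_Suc2)
  qed
  then have "(of_nat (i ^ CARD('p)) :: 'p mod_ring) = of_nat i"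
    by (simp only: of_nat_eq_iff_cong_CHAR semiring_char_mod_ring)
  then show ?thesis using i by simp
qed

text \<open>The additivity of the p-th power is applied to finite sums, so the coefficient at
  \<open>n\<close> is computed from the truncation \<open>T\<close>; the tail starts contributing at
  degree \<open>Suc n * p\<close>. The coefficients themselves are fixed by Fermat's little
  theorem.\<close>

lemma fps_power_card:
  fixes F :: "'p::prime_card mod_ring fps"
  shows "F ^ CARD('p) = F oo fps_X ^ CARD('p)"
proof (rule fps_ext)
  fix n
  let ?p = "CARD('p)"
  have p: "prime ?p" "?p > 0" using prime_card prime_gt_0_nat by blast+
  define T where "T = (\<Sum>i\<le>n. fps_const (fps_nth F i) * fps_X ^ i)"
  define R where "R = fps_shift (Suc n) F"
  have T_nth: "fps_nth T m = (if m \<le> n then fps_nth F m else 0)" for m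
    by (auto simp: T_def fps_sum_nth fps_X_power_nth if_distrib cong: if_cong)
  have "F = T + R * fps_X ^ Suc n"
    by (rule fps_ext) (auto simp: T_nth R_def fps_X_power_mult_right_nth simp del: power_Suc)
  then have "F ^ ?p = T ^ ?p + (R * fps_X ^ Suc n) ^ ?p"
    by (metis CHAR_fps semiring_char_mod_ring freshmans_dream p(1))
  also have "fps_nth \<dots> n = fps_nth (T ^ ?p) n"
  proof -
    have "n < Suc n * ?p" using p(2) by (cases ?p) auto
    then show ?thesis
      by (simp add: power_mult_distrib fps_X_power_mult_right_nth del: power_Suc flip: power_mult)
  qed
  also have "T ^ ?p = (\<Sum>i\<le>n. (fps_const (fps_nth F i) * fps_X ^ i) ^ ?p)"
    unfolding T_def by (rule freshmans_dream_sum) (simp_all add: CHAR_fps prime_card)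
  also have "\<dots> = (\<Sum>i\<le>n. fps_const (fps_nth F i) * fps_X ^ (?p * i))"
    by (simp add: power_mult_distrib fps_const_power mult.commute flip: power_mult)
  also have "fps_nth \<dots> n = fps_nth (F oo fps_X ^ ?p) n"
    unfolding fps_compose_nth fps_sum_nth by (intro sum.cong) (auto simp flip: power_mult)
  finally show "fps_nth (F ^ ?p) n = fps_nth (F oo fps_X ^ ?p) n" .
qed

section \<open>Logarithmic derivatives\<close>

lemma fps_X_mult_deriv_nth: "fps_nth (fps_X * fps_deriv F) n = of_nat n * fps_nth F n"
  by (cases n) auto

text \<open>The operator x d/dx multiplies the coefficient at x^(p^i) by p^i and so clears the
  denominators of the Artin-Hasse logarithm. Identities between exponentials become additive
  identities between integral series.\<close>

definition has_logderiv :: "'a::field_char_0 fps \<Rightarrow> 'a fps \<Rightarrow> bool" where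
  "has_logderiv F l \<longleftrightarrow> fps_nth F 0 = 1 \<and> fps_X * fps_deriv F = l * F"

text \<open>As \<open>l\<close> has no constant term, \<open>n\<close> times the coefficient at
  \<open>n\<close> is a convolution with earlier coefficients; characteristic 0 allows the division
  by \<open>n\<close>.\<close>

lemma has_logderiv_unique:
  assumes "has_logderiv F l" "has_logderiv G l"
  shows "F = G"
proof (rule fps_ext)
  fix n
  have l0: "fps_nth l 0 = 0"
    using assms(1) unfolding has_logderiv_def by (auto dest: arg_cong[where f = "\<lambda>F. fps_nth F 0"])
  have rec: "of_nat m * fps_nth H m = (\<Sum>i=1..m. fps_nth l i * fps_nth H (m - i))"
    if "has_logderiv H l" for H m
  proof -
    have "of_nat m * fps_nth H m = fps_nth (fps_X * fps_deriv H) m"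
      by (simp add: fps_X_mult_deriv_nth)
    also have "\<dots> = (\<Sum>i=0..m. fps_nth l i * fps_nth H (m - i))"
      using that by (simp add: has_logderiv_def fps_mult_nth)
    also have "\<dots> = (\<Sum>i=1..m. fps_nth l i * fps_nth H (m - i))"
      by (subst sum.atLeast_Suc_atMost) (auto simp: l0)
    finally show ?thesis .
  qed
  show "fps_nth F n = fps_nth G n"
  proof (induction n rule: less_induct)
    case (less n)
    show ?case
    proof (cases "n = 0")
      case False
      have "of_nat n * fps_nth F n = of_nat n * fps_nth G n"
        unfolding rec[OF assms(1)] rec[OF assms(2)]
        by (intro sum.cong arg_cong2[of _ _ _ _ "(*)"] less) auto
      with False show ?thesis by simp
    qed (use assms in \<open>simp add: has_logderiv_def\<close>)
  qed
qed

lemma has_logderiv_1: "has_logderiv 1 0"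
  by (simp add: has_logderiv_def)

lemma has_logderiv_mult:
  "has_logderiv F k \<Longrightarrow> has_logderiv G l \<Longrightarrow> has_logderiv (F * G) (k + l)"
  unfolding has_logderiv_def by (simp add: algebra_simps) algebra

lemma has_logderiv_power: "has_logderiv F l \<Longrightarrow> has_logderiv (F ^ n) (of_nat n * l)"
  by (induction n) (auto simp: has_logderiv_1 algebra_simps dest: has_logderiv_mult)

lemma has_logderiv_compose_X_power:
  assumes "has_logderiv F l" "k > 0"
  shows "has_logderiv (F oo fps_X ^ k) (of_nat k * (l oo fps_X ^ k))"
proof -
  have X0: "fps_nth (fps_X ^ k :: 'a fps) 0 = 0" using assms(2) by simp
  have "fps_X * fps_deriv (F oo fps_X ^ k) = of_nat k * (fps_X ^ k * (fps_deriv F oo fps_X ^ k))"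
  proof -
    have "fps_X * fps_deriv (fps_X ^ k) = (of_nat k * fps_X ^ k :: 'a fps)"
      by (rule fps_ext) (simp add: fps_X_mult_deriv_nth fps_X_power_nth flip: fps_of_nat)
    then show ?thesis unfolding fps_compose_deriv[OF X0] by (simp add: mult_ac)
  qed
  also have "fps_X ^ k * (fps_deriv F oo fps_X ^ k) = (fps_X * fps_deriv F) oo fps_X ^ k"
    using X0 by (simp add: fps_compose_mult_distrib)
  also have "fps_X * fps_deriv F = l * F" using assms(1) by (simp add: has_logderiv_def)
  finally show ?thesis
    using assms(1) by (simp add: has_logderiv_def fps_compose_mult_distrib[OF X0] mult.assoc)
qed

lemma has_logderiv_exp:
  assumes "fps_nth L 0 = 0"
  shows "has_logderiv (fps_exp c oo L) (fps_const c * (fps_X * fps_deriv L))"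
  using assms by (simp add: has_logderiv_def fps_compose_deriv fps_compose_mult_distrib mult_ac)

text \<open>For \<open>p > 1\<close> at most one index contributes; writing a sum makes linearity in
  \<open>t\<close> immediate.\<close>

definition pow_series :: "nat \<Rightarrow> (nat \<Rightarrow> 'a) \<Rightarrow> 'a::field fps" where
  "pow_series p t = Abs_fps (\<lambda>n. \<Sum>i | p ^ i = n. t i)"

lemma pow_series_nth_power [simp]: "p > 1 \<Longrightarrow> fps_nth (pow_series p t) (p ^ i) = t i"
  by (simp add: pow_series_def)

lemma pow_series_nth_eq_0: "(\<And>i. n \<noteq> p ^ i) \<Longrightarrow> fps_nth (pow_series p t) n = 0"
  by (auto simp: pow_series_def intro!: sum.neutral)

lemma pow_series_nth_0 [simp]: "p > 1 \<Longrightarrow> fps_nth (pow_series p t) 0 = 0"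
  by (rule pow_series_nth_eq_0) auto

lemma pow_series_add: "pow_series p s + pow_series p t = pow_series p (\<lambda>i. s i + t i)"
  by (simp add: fps_eq_iff pow_series_def sum.distrib)

lemma pow_series_cmult: "fps_const c * pow_series p t = pow_series p (\<lambda>i. c * t i)"
  by (simp add: fps_eq_iff pow_series_def sum_distrib_left)

lemma fps_eq_pow_seriesI:
  assumes "\<And>i. fps_nth F (p ^ i) = t i" "\<And>n. (\<And>i. n \<noteq> p ^ i) \<Longrightarrow> fps_nth F n = 0" "p > 1"
  shows "F = pow_series p t"
proof (rule fps_ext)
  show "fps_nth F n = fps_nth (pow_series p t) n" for n
    using assms by (cases "\<exists>i. n = p ^ i") (auto simp: pow_series_nth_eq_0)
qed

lemma X_deriv_pow_series:
  assumes "p > 1"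
  shows "fps_X * fps_deriv (pow_series p t) = pow_series p (\<lambda>i. of_nat (p ^ i) * t i)"
proof -
  show ?thesis using assms
    by (intro fps_eq_pow_seriesI) (auto simp: fps_X_mult_deriv_nth pow_series_nth_eq_0 simp del: of_nat_power)
qed

lemma pow_series_compose_X_power:
  assumes "p > 1"
  shows "pow_series p t oo fps_X ^ p = pow_series p (\<lambda>i. if i = 0 then 0 else t (i - 1))"
proof (rule fps_eq_pow_seriesI)
  fix i
  show "fps_nth (pow_series p t oo fps_X ^ p) (p ^ i) = (if i = 0 then 0 else t (i - 1))"
    using assms by (cases i) (auto simp: fps_compose_X_power_nth)
next
  fix n assume n: "\<And>i. n \<noteq> p ^ i"
  have "n div p \<noteq> p ^ i" if "p dvd n" for i
    using n[of "Suc i"] assms that by auto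
  then show "fps_nth (pow_series p t oo fps_X ^ p) n = 0"
    using assms by (simp add: fps_compose_X_power_nth pow_series_nth_eq_0)
qed fact

section \<open>p-adic powers of the Artin--Hasse exponential\<close>

text \<open>One step of Legendre's formula: the multiples of \<open>p\<close> up to \<open>n\<close>
  contribute \<open>p ^ (n div p) * fact (n div p)\<close>, all other factors go into
  \<open>u\<close>.\<close>

lemma fact_p_free_part:
  assumes "prime p"
  shows "\<exists>u. \<not> p dvd u \<and> fact n = u * p ^ (n div p) * (fact (n div p) :: nat)"
proof (induction n)
  case 0
  show ?case using assms by (auto intro!: exI[of _ 1] dest: prime_gt_1_nat)
next
  case (Suc n)
  then obtain u where u: "\<not> p dvd u" "fact n = u * p ^ (n div p) * (fact (n div p) :: nat)" by blast
  show ?case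
  proof (cases "p dvd Suc n")
    case True
    then have k1: "Suc n div p = Suc (n div p)" by (simp add: div_Suc mod_eq_0_iff_dvd)
    have "Suc n = p * (Suc n div p)" using True by (rule dvd_mult_div_cancel[symmetric])
    then have k2: "Suc n = p * Suc (n div p)" by (simp only: k1)
    have "fact (Suc n) = Suc n * fact n" by simp
    also have "\<dots> = u * p ^ Suc (n div p) * fact (Suc (n div p))"
      by (subst k2) (simp add: u(2) algebra_simps)
    finally show ?thesis unfolding k1 using u(1) by blast
  next
    case False
    then have "Suc n div p = n div p" by (simp add: div_Suc mod_eq_0_iff_dvd)
    moreover have "\<not> p dvd u * Suc n"
      using u(1) False assms prime_dvd_mult_iff by blast
    moreover have "fact (Suc n) = u * Suc n * p ^ (n div p) * fact (n div p)"
      using u(2) by (simp add: algebra_simps)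
    ultimately show ?thesis by (intro exI[of _ "u * Suc n"]) simp
  qed
qed

text \<open>With \<open>k = n div p\<close>, the exponent of \<open>p\<close> in
  \<open>fact n\<close> is \<open>k\<close> plus the one in \<open>fact k\<close>. For
  \<open>k > 0\<close> induction bounds it by \<open>k + (k - 1)\<close>, which is at most
  \<open>n - 1\<close> because \<open>2 * k \<le> n\<close>.\<close>

lemma p_integral_power_divide_fact:
  assumes "prime p" "n > 0"
  shows "p_integral p (of_nat p ^ (n - 1) / fact n)"
  using assms(2)
proof (induction n rule: less_induct)
  case (less n)
  define k where "k = n div p"
  obtain u where u: "\<not> p dvd u" "fact n = u * p ^ k * (fact k :: nat)"
    using fact_p_free_part[OF assms(1)] unfolding k_def by blast
  have p2: "p \<ge> 2" using assms(1) by (rule prime_ge_2_nat)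
  have fact_n: "(fact n :: rat) = of_nat u * of_nat p ^ k * fact k"
    using arg_cong[OF u(2), of "of_nat :: nat \<Rightarrow> rat"] by simp
  have inv_u: "p_integral p (1 / of_nat u)"
    unfolding p_integral_def using u(1) by (intro exI[of _ 1] exI[of _ "int u"]) auto
  show ?case
  proof (cases "k = 0")
    case True
    have "of_nat p ^ (n - 1) / fact n = of_nat (p ^ (n - 1)) * (1 / of_nat u :: rat)"
      using True fact_n by simp
    then show ?thesis
      by (simp only: p_integral_mult[OF assms(1) p_integral_of_nat[OF assms(1)] inv_u])
  next
    case False
    have "k * 2 \<le> k * p" using p2 by simp
    also have "k * p \<le> n" unfolding k_def by simp
    finally have k2: "2 * k \<le> n" by simp
    have "k < n" using k2 False by simp
    have "(of_nat p :: rat) ^ (n - 1) = of_nat p ^ (n - 2 * k) * of_nat p ^ (k - 1) * of_nat p ^ k"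
      using k2 False by (simp flip: power_add)
    then have "of_nat p ^ (n - 1) / fact n =
        of_nat (p ^ (n - 2 * k)) * (1 / of_nat u) * (of_nat p ^ (k - 1) / fact k :: rat)"
      using fact_n p2 by simp
    then show ?thesis
      using less.IH[OF \<open>k < n\<close>] False
      by (simp only: p_integral_mult[OF assms(1)] p_integral_of_nat[OF assms(1)] inv_u neq0_conv)
  qed
qed

lemma power_Suc_add_eq:
  fixes a b :: "'a::comm_ring_1"
  shows "\<exists>z. (a + b) ^ Suc n = a ^ Suc n + of_nat (Suc n) * a ^ n * b + b\<^sup>2 * z"
proof (induction n)
  case 0
  show ?case by (intro exI[of _ 0]) simp
next
  case (Suc n)
  then obtain z where z: "(a + b) ^ Suc n = a ^ Suc n + of_nat (Suc n) * a ^ n * b + b\<^sup>2 * z" by blast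
  have "(a + b) ^ Suc (Suc n) = (a + b) * (a ^ Suc n + of_nat (Suc n) * a ^ n * b + b\<^sup>2 * z)"
    using z by simp
  also have "\<dots> = a ^ Suc (Suc n) + of_nat (Suc (Suc n)) * a ^ Suc n * b
                  + b\<^sup>2 * (of_nat (Suc n) * a ^ n + (a + b) * z)"
    by (simp add: algebra_simps power2_eq_square)
  finally show ?case by blast
qed

text \<open>
  One direction of the Dieudonne--Dwork criterion: comparing coefficients in the functional
  equation expresses p times the n-th coefficient of F through the earlier ones, and the
  Frobenius congruence makes the result divisible by p.
\<close>

lemma dieudonne_dwork:
  fixes F H :: "rat fps"
  defines "p \<equiv> CARD('p::prime_card)"
  assumes F0: "fps_nth F 0 = 1" and eq: "F ^ p = (F oo fps_X ^ p) * H"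
    and H0: "fps_nth H 0 = 1" and H: "\<And>n. n > 0 \<Longrightarrow> p_integral p (fps_nth H n / of_nat p)"
  shows "p_integral_fps p F"
proof -
  have p: "prime p" "p > 0" "p > 1"
    unfolding p_def using prime_card[where 'a = 'p] prime_gt_0_nat prime_gt_1_nat by blast+
  have "p_integral p (fps_nth F n)" for n
  proof (induction n rule: less_induct)
    case (less n)
    show ?case
    proof (cases "n = 0")
      case False
      then have "n > 0" by simp
      \<comment> \<open>After this cut at degree \<open>n\<close>, the unknown coefficient enters
        \<open>F ^ p\<close> only through the linear term, with factor \<open>p\<close>: the higher
        terms start at degree \<open>2 * n\<close>.\<close>
      define T where "T = Abs_fps (\<lambda>i. if i < n then fps_nth F i else 0)"
      define R where "R = fps_shift n F"
      have T: "p_integral_fps p T" using less p by (simp add: p_integral_fps_def T_def)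
      have F_eq: "F = T + R * fps_X ^ n"
        by (rule fps_ext) (auto simp: T_def R_def fps_X_power_mult_right_nth)
      obtain z where z: "(T + R * fps_X ^ n) ^ p =
          T ^ p + of_nat p * T ^ (p - 1) * (R * fps_X ^ n) + (R * fps_X ^ n)\<^sup>2 * z"
        using power_Suc_add_eq[of T "R * fps_X ^ n" "p - 1"] p by auto
      have "fps_nth (F ^ p) n = fps_nth (T ^ p) n + of_nat p * fps_nth F n"
      proof -
        have "fps_nth (of_nat p * T ^ (p - 1) * (R * fps_X ^ n)) n = of_nat p * fps_nth F n"
          using \<open>n > 0\<close> F0
          by (simp add: mult.assoc[symmetric] fps_X_power_mult_right_nth T_def R_def fps_power_zeroth
              flip: fps_of_nat)
        moreover have "(R * fps_X ^ n)\<^sup>2 * z = R\<^sup>2 * z * fps_X ^ (2 * n)"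
          by (simp add: power_mult_distrib mult_ac flip: power_mult)
        then have "fps_nth ((R * fps_X ^ n)\<^sup>2 * z) n = 0"
          using \<open>n > 0\<close> by (simp only: fps_X_power_mult_right_nth) simp
        ultimately show ?thesis by (subst F_eq, subst z) simp
      qed
      moreover have "fps_nth (F ^ p) n = fps_nth (T oo fps_X ^ p) n +
          of_nat p * (\<Sum>i<n. fps_nth (F oo fps_X ^ p) i * (fps_nth H (n - i) / of_nat p))"
      proof -
        have "fps_nth (F ^ p) n = (\<Sum>i\<le>n. fps_nth (F oo fps_X ^ p) i * fps_nth H (n - i))"
          by (simp add: eq fps_mult_nth atLeast0AtMost)
        also have "\<dots> = fps_nth (F oo fps_X ^ p) n
            + (\<Sum>i<n. fps_nth (F oo fps_X ^ p) i * fps_nth H (n - i))"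
          using H0 by (simp add: lessThan_Suc_atMost[symmetric])
        also have "fps_nth (F oo fps_X ^ p) n = fps_nth (T oo fps_X ^ p) n"
          using p \<open>n > 0\<close> by (simp add: fps_compose_X_power_nth T_def)
        finally show ?thesis using p by (simp add: sum_distrib_left)
      qed
      ultimately have "of_nat p * fps_nth F n = (fps_nth (T oo fps_X ^ p) n - fps_nth (T ^ p) n) +
          of_nat p * (\<Sum>i<n. fps_nth (F oo fps_X ^ p) i * (fps_nth H (n - i) / of_nat p))"
        by simp
      then have F_n: "fps_nth F n = (fps_nth (T oo fps_X ^ p) n - fps_nth (T ^ p) n) / of_nat p +
          (\<Sum>i<n. fps_nth (F oo fps_X ^ p) i * (fps_nth H (n - i) / of_nat p))"
        using p by (simp add: field_simps)
      have int: "p_integral p (fps_nth (T oo fps_X ^ p) n)" "p_integral p (fps_nth (T ^ p) n)"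
        using p_integral_fps_compose_X_power[OF p(1,2) T] p_integral_fps_power[OF p(1) T]
        by (auto simp: p_integral_fps_def)
      have "(fps_reduce (T oo fps_X ^ p) :: 'p mod_ring fps) = fps_reduce (T ^ p)"
        using fps_reduce_power[where 'p = 'p, of T p] T fps_power_card[of "fps_reduce T :: 'p mod_ring fps"]
        by (simp add: fps_reduce_compose_X_power p_def)
      then have red: "(rat_reduce (fps_nth (T oo fps_X ^ p) n) :: 'p mod_ring) = rat_reduce (fps_nth (T ^ p) n)"
        by (simp add: fps_reduce_def fps_eq_iff)
      have "(rat_reduce (fps_nth (T oo fps_X ^ p) n - fps_nth (T ^ p) n) :: 'p mod_ring) = 0"
        using rat_reduce_add[where 'p = 'p,
            OF p_integral_diff[OF p(1) int, unfolded p_def] int(2)[unfolded p_def]] red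
        by (simp add: p_def)
      then have "p_integral p ((fps_nth (T oo fps_X ^ p) n - fps_nth (T ^ p) n) / of_nat p)"
        unfolding p_def
        by (intro rat_reduce_eq_0_imp_p_integral_divide)
           (use p_integral_diff[OF p(1) int] in \<open>simp_all add: p_def\<close>)
      moreover have "p_integral p (fps_nth (F oo fps_X ^ p) i * (fps_nth H (n - i) / of_nat p))"
        if "i < n" for i
      proof -
        have "i div p < n" using that by (meson div_le_dividend le_less_trans)
        then have "p_integral p (fps_nth (F oo fps_X ^ p) i)"
          using less p by (simp add: fps_compose_X_power_nth)
        then show ?thesis using that p by (intro p_integral_mult H) auto
      qed
      ultimately show ?thesis unfolding F_n
        using p by (intro p_integral_add p_integral_sum) auto
    qed (simp add: F0 p)
  qed
  then show ?thesis by (simp add: p_integral_fps_def)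
qed

section \<open>Exponents given by digit sequences\<close>

text \<open>The upper limit is inclusive, so \<open>digit_sum p b i\<close> represents the p-adic
  integer modulo \<open>p ^ Suc i\<close>.\<close>

definition digit_sum :: "nat \<Rightarrow> (nat \<Rightarrow> nat) \<Rightarrow> nat \<Rightarrow> nat" where
  "digit_sum p b i = (\<Sum>j\<le>i. b j * p ^ j)"

lemma digit_sum_0 [simp]: "digit_sum p b 0 = b 0"
  and digit_sum_Suc: "digit_sum p b (Suc i) = digit_sum p b i + b (Suc i) * p ^ Suc i"
  by (simp_all add: digit_sum_def)

lemma digit_sum_Suc_shift: "digit_sum p b (Suc i) = b 0 + p * digit_sum p (\<lambda>j. b (Suc j)) i"
  by (simp add: digit_sum_def sum.atMost_Suc_shift sum_distrib_left mult_ac del: sum.atMost_Suc)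

text \<open>
  Formally the power of the Artin--Hasse exponential whose exponent is the p-adic integer with
  digits b (digits need not be smaller than p).
\<close>

definition artin_hasse_power :: "nat \<Rightarrow> (nat \<Rightarrow> nat) \<Rightarrow> rat fps" where
  "artin_hasse_power p b = fps_exp 1 oo pow_series p (\<lambda>i. of_nat (digit_sum p b i) / of_nat (p ^ i))"

lemma has_logderiv_artin_hasse_power:
  assumes "p > 1"
  shows "has_logderiv (artin_hasse_power p b) (pow_series p (\<lambda>i. of_nat (digit_sum p b i)))"
proof -
  have "has_logderiv (artin_hasse_power p b) (fps_const 1 * (fps_X *
      fps_deriv (pow_series p (\<lambda>i. of_nat (digit_sum p b i) / of_nat (p ^ i)))))"
    unfolding artin_hasse_power_def by (rule has_logderiv_exp) (use assms in simp)
  then show ?thesis using assms by (simp add: X_deriv_pow_series)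
qed

lemma has_logderiv_artin_hasse:
  assumes "p > 1"
  shows "has_logderiv (artin_hasse p) (pow_series p (\<lambda>_. 1))"
proof -
  have "artin_hasse_log p = pow_series p (\<lambda>i. 1 / of_nat (p ^ i))"
    unfolding artin_hasse_log_eq[OF assms] using assms by (intro fps_eq_pow_seriesI) auto
  moreover have "has_logderiv (artin_hasse p) (fps_const 1 * (fps_X *
      fps_deriv (pow_series p (\<lambda>i. 1 / of_nat (p ^ i)))))"
    unfolding artin_hasse_def calculation by (rule has_logderiv_exp) (use assms in simp)
  ultimately show ?thesis using assms by (simp add: X_deriv_pow_series)
qed

text \<open>Behind \<open>artin_hasse_power\<close> stands the product over j of the
  \<open>b j\<close>-th powers of E(x^(p^j)): the logarithm of this product has coefficient
  \<open>digit_sum p b i\<close> divided by \<open>p ^ i\<close> at x^(p^i). Here the factor j = 0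
  is split off.\<close>

lemma artin_hasse_power_shift:
  assumes "p > 1"
  shows "artin_hasse_power p b =
           artin_hasse p ^ b 0 * (artin_hasse_power p (\<lambda>i. b (Suc i)) oo fps_X ^ p)"
proof (rule has_logderiv_unique)
  have "has_logderiv (artin_hasse p ^ b 0 * (artin_hasse_power p (\<lambda>i. b (Suc i)) oo fps_X ^ p))
     (of_nat (b 0) * pow_series p (\<lambda>_. 1) +
      of_nat p * (pow_series p (\<lambda>i. of_nat (digit_sum p (\<lambda>i. b (Suc i)) i)) oo fps_X ^ p))"
    using assms by (intro has_logderiv_mult has_logderiv_power has_logderiv_compose_X_power
        has_logderiv_artin_hasse has_logderiv_artin_hasse_power) auto
  also have "\<dots> = pow_series p (\<lambda>i. of_nat (digit_sum p b i))"
    unfolding pow_series_compose_X_power[OF assms] fps_of_nat[symmetric] pow_series_cmult pow_series_add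
  proof (rule arg_cong[of _ _ "pow_series p"], rule ext)
    fix i
    show "of_nat (b 0) * 1 + of_nat p * (if i = 0 then 0
            else of_nat (digit_sum p (\<lambda>i. b (Suc i)) (i - 1))) = (of_nat (digit_sum p b i) :: rat)"
      by (cases i) (auto simp: digit_sum_Suc_shift)
  qed
  finally show "has_logderiv (artin_hasse p ^ b 0 * (artin_hasse_power p (\<lambda>i. b (Suc i)) oo fps_X ^ p))
     (pow_series p (\<lambda>i. of_nat (digit_sum p b i)))" .
qed (rule has_logderiv_artin_hasse_power[OF assms])

text \<open>This is the functional equation for the criterion. Substituting x^p shifts the digit
  sums by one place, so at x^(p^i) the logarithmic derivatives differ by
  \<open>p * (b i * p ^ i)\<close>, the contribution of the last digit.\<close>

lemma artin_hasse_power_frobenius: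
  assumes "p > 1"
  shows "artin_hasse_power p b ^ p =
    (artin_hasse_power p b oo fps_X ^ p) * (fps_exp (of_nat p) oo pow_series p (\<lambda>i. of_nat (b i)))"
proof (rule has_logderiv_unique)
  show "has_logderiv (artin_hasse_power p b ^ p)
          (of_nat p * pow_series p (\<lambda>i. of_nat (digit_sum p b i)))"
    by (intro has_logderiv_power has_logderiv_artin_hasse_power assms)
  have "has_logderiv ((artin_hasse_power p b oo fps_X ^ p) *
      (fps_exp (of_nat p) oo pow_series p (\<lambda>i. of_nat (b i))))
     (of_nat p * (pow_series p (\<lambda>i. of_nat (digit_sum p b i)) oo fps_X ^ p) +
      fps_const (of_nat p) * (fps_X * fps_deriv (pow_series p (\<lambda>i. of_nat (b i)))))"
    using assms by (intro has_logderiv_mult has_logderiv_exp has_logderiv_compose_X_power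
        has_logderiv_artin_hasse_power) auto
  also have "\<dots> = of_nat p * pow_series p (\<lambda>i. of_nat (digit_sum p b i))"
    unfolding pow_series_compose_X_power[OF assms] X_deriv_pow_series[OF assms]
      fps_of_nat[symmetric] pow_series_cmult pow_series_add
  proof (rule arg_cong[of _ _ "pow_series p"], rule ext)
    fix i
    show "of_nat p * (if i = 0 then 0 else of_nat (digit_sum p b (i - 1))) +
            of_nat p * (of_nat (p ^ i) * of_nat (b i)) = (of_nat p * of_nat (digit_sum p b i) :: rat)"
      by (cases i) (auto simp: digit_sum_Suc algebra_simps)
  qed
  finally show "has_logderiv ((artin_hasse_power p b oo fps_X ^ p) *
      (fps_exp (of_nat p) oo pow_series p (\<lambda>i. of_nat (b i))))
     (of_nat p * pow_series p (\<lambda>i. of_nat (digit_sum p b i)))" .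
qed

text \<open>The correction factor is the exponential of \<open>p\<close> times the integral series
  \<open>S\<close>; its terms of index \<open>i > 0\<close> carry \<open>p ^ i / fact i\<close>,
  which is still integral after division by \<open>p\<close>.\<close>

lemma p_integral_artin_hasse_power: "p_integral_fps CARD('p::prime_card) (artin_hasse_power CARD('p) b)"
proof -
  define p where "p = CARD('p)"
  have p: "prime p" "p > 1"
    unfolding p_def using prime_card[where 'a = 'p] prime_gt_1_nat by blast+
  define S where "S = pow_series p (\<lambda>i. of_nat (b i) :: rat)"
  define H where "H = (fps_exp (of_nat p) oo S)"
  have S: "p_integral_fps p S"
    using p by (auto simp: p_integral_fps_def S_def pow_series_def intro!: p_integral_sum)
  have H_n: "p_integral p (fps_nth H n / of_nat p)" if "n > 0" for n
  proof -
    have "fps_nth H n / of_nat p = (\<Sum>i=0..n. fps_nth (fps_exp (of_nat p)) i * fps_nth (S ^ i) n / of_nat p)"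
      by (simp add: H_def fps_compose_nth sum_divide_distrib)
    moreover have "p_integral p (fps_nth (fps_exp (of_nat p)) i * fps_nth (S ^ i) n / of_nat p)" for i
    proof (cases "i = 0")
      case False
      then have "of_nat p ^ i = of_nat p * (of_nat p ^ (i - 1) :: rat)" by (cases i) auto
      then have eq: "fps_nth (fps_exp (of_nat p)) i * fps_nth (S ^ i) n / of_nat p =
          (of_nat p ^ (i - 1) / fact i) * fps_nth (S ^ i) n"
        using p by simp
      have "p_integral p (fps_nth (S ^ i) n)"
        using p_integral_fps_power[OF p(1) S] by (simp add: p_integral_fps_def)
      then show ?thesis unfolding eq
        using False by (intro p_integral_mult[OF p(1)] p_integral_power_divide_fact[OF p(1)]) auto
    qed (use that p in simp)
    ultimately show ?thesis using p by (auto intro!: p_integral_sum)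
  qed
  have "p_integral_fps CARD('p) (artin_hasse_power p b)"
  proof (rule dieudonne_dwork)
    show "artin_hasse_power p b ^ CARD('p) = (artin_hasse_power p b oo fps_X ^ CARD('p)) * H"
      using artin_hasse_power_frobenius[OF p(2), of b] by (simp add: H_def S_def p_def)
    show "p_integral CARD('p) (fps_nth H n / of_nat CARD('p))" if "n > 0" for n
      using H_n[OF that] by (simp add: p_def)
  qed (simp_all add: artin_hasse_power_def H_def)
  then show ?thesis by (simp add: p_def)
qed

lemma artin_hasse_power_one:
  assumes "p > 1"
  shows "artin_hasse_power p (\<lambda>i. if i = 0 then 1 else 0) = artin_hasse p"
proof (rule has_logderiv_unique)
  have "digit_sum p (\<lambda>i. if i = 0 then 1 else 0) i = 1" for i
    by (induction i) (auto simp: digit_sum_Suc)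
  then show "has_logderiv (artin_hasse_power p (\<lambda>i. if i = 0 then 1 else 0)) (pow_series p (\<lambda>_. 1))"
    using has_logderiv_artin_hasse_power[OF assms, of "\<lambda>i. if i = 0 then 1 else 0"] by simp
qed (rule has_logderiv_artin_hasse[OF assms])

lemma p_integral_artin_hasse: "p_integral_fps CARD('p::prime_card) (artin_hasse CARD('p))"
  using p_integral_artin_hasse_power[where 'p = 'p]
    artin_hasse_power_one[OF prime_gt_1_nat[OF prime_card[where 'a = 'p]]] by metis

lemma fps_reduce_artin_hasse_power_shift:
  defines "p \<equiv> CARD('p::prime_card)"
  shows "(fps_reduce (artin_hasse_power p b) :: 'p mod_ring fps) =
    fps_reduce (artin_hasse p) ^ b 0 * fps_reduce (artin_hasse_power p (\<lambda>i. b (Suc i))) ^ p"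
proof -
  have p: "prime p" "p > 1" "p > 0"
    unfolding p_def using prime_card[where 'a = 'p] prime_gt_1_nat by auto
  have int: "p_integral_fps p (artin_hasse p)" "p_integral_fps p (artin_hasse_power p b)" for b
    unfolding p_def by (rule p_integral_artin_hasse p_integral_artin_hasse_power)+
  let ?G = "artin_hasse_power p (\<lambda>i. b (Suc i))"
  have "(fps_reduce (artin_hasse_power p b) :: 'p mod_ring fps) =
      fps_reduce (artin_hasse p ^ b 0) * fps_reduce (?G oo fps_X ^ p)"
    unfolding artin_hasse_power_shift[OF p(2), of b]
    by (rule fps_reduce_mult; fold p_def)
       (intro p_integral_fps_power p_integral_fps_compose_X_power int p)+
  also have "(fps_reduce (artin_hasse p ^ b 0) :: 'p mod_ring fps) = fps_reduce (artin_hasse p) ^ b 0"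
    by (rule fps_reduce_power) (use int in \<open>simp add: p_def\<close>)
  also have "fps_reduce (?G oo fps_X ^ p) = (fps_reduce ?G :: 'p mod_ring fps) oo fps_X ^ p"
    by (rule fps_reduce_compose_X_power) fact
  also have "\<dots> = fps_reduce ?G ^ p"
    unfolding p_def by (rule fps_power_card[symmetric])
  finally show ?thesis .
qed

text \<open>Modulo \<open>p\<close> the substitution of x^p is the p-th power, so the digits up to
  \<open>j\<close> can be peeled off into a genuine power of the reduced series. What remains is a
  \<open>p ^ Suc j\<close>-th power and therefore sparse.\<close>

lemma fps_reduce_artin_hasse_power_eq:
  defines "p \<equiv> CARD('p::prime_card)"
  shows "(fps_reduce (artin_hasse_power p b) :: 'p mod_ring fps) =
    fps_reduce (artin_hasse p) ^ digit_sum p b j *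
    fps_reduce (artin_hasse_power p (\<lambda>i. b (i + Suc j))) ^ (p ^ Suc j)"
proof (induction j arbitrary: b)
  case 0
  show ?case using fps_reduce_artin_hasse_power_shift[where 'p = 'p, of b] by (simp add: p_def)
next
  case (Suc j)
  define b' where "b' = (\<lambda>i. b (Suc i))"
  have "(fps_reduce (artin_hasse_power p b) :: 'p mod_ring fps) =
      fps_reduce (artin_hasse p) ^ b 0 * fps_reduce (artin_hasse_power p b') ^ p"
    unfolding p_def b'_def by (rule fps_reduce_artin_hasse_power_shift)
  also have "fps_reduce (artin_hasse_power p b') = fps_reduce (artin_hasse p) ^ digit_sum p b' j *
      (fps_reduce (artin_hasse_power p (\<lambda>i. b' (i + Suc j))) ^ (p ^ Suc j) :: 'p mod_ring fps)"
    by (rule Suc)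
  finally show ?case
    by (simp add: digit_sum_Suc_shift b'_def power_mult_distrib power_add mult_ac flip: power_mult)
qed

section \<open>Transcendence from an irrational exponent\<close>

text \<open>Substitution and extension of scalars in one map, used over the rationals and over the
  prime field; \<open>c = 1\<close> is the mere embedding.\<close>

definition fps_ac_scale :: "'a::field alg_closure \<Rightarrow> 'a fps \<Rightarrow> 'a alg_closure fps" where
  "fps_ac_scale c F = Abs_fps (\<lambda>n. c ^ n * to_ac (fps_nth F n))"

lemma fps_ac_scale_nth [simp]: "fps_nth (fps_ac_scale c F) n = c ^ n * to_ac (fps_nth F n)"
  by (simp add: fps_ac_scale_def)

lemma fps_ac_scale_0 [simp]: "fps_ac_scale c 0 = 0"
  by (simp add: fps_eq_iff)

lemma fps_ac_scale_1 [simp]: "fps_ac_scale c 1 = 1"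
  by (simp add: fps_eq_iff fps_one_def)

lemma fps_ac_scale_add: "fps_ac_scale c (F + G) = fps_ac_scale c F + fps_ac_scale c G"
  by (simp add: fps_eq_iff algebra_simps)

lemma fps_ac_scale_mult: "fps_ac_scale c (F * G) = fps_ac_scale c F * fps_ac_scale c G"
proof (rule fps_ext)
  fix n
  have "c ^ n * to_ac (\<Sum>i=0..n. fps_nth F i * fps_nth G (n - i)) =
      (\<Sum>i=0..n. (c ^ i * to_ac (fps_nth F i)) * (c ^ (n - i) * to_ac (fps_nth G (n - i))))"
    unfolding to_ac_sum sum_distrib_left
  proof (rule sum.cong)
    fix i assume "i \<in> {0..n}"
    then have "c ^ n = c ^ i * c ^ (n - i)" by (simp flip: power_add)
    then show "c ^ n * to_ac (fps_nth F i * fps_nth G (n - i)) =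
        (c ^ i * to_ac (fps_nth F i)) * (c ^ (n - i) * to_ac (fps_nth G (n - i)))"
      by simp
  qed simp
  then show "fps_nth (fps_ac_scale c (F * G)) n = fps_nth (fps_ac_scale c F * fps_ac_scale c G) n"
    by (simp add: fps_mult_nth)
qed

lemma fps_ac_scale_power: "fps_ac_scale c (F ^ n) = fps_ac_scale c F ^ n"
  by (induction n) (simp_all add: fps_ac_scale_mult)

lemma fps_ac_scale_sum: "fps_ac_scale c (sum F I) = (\<Sum>i\<in>I. fps_ac_scale c (F i))"
  by (induction I rule: infinite_finite_induct) (simp_all add: fps_ac_scale_add)

lemma fps_ac_scale_1_inject: "fps_ac_scale 1 F = fps_ac_scale 1 G \<longleftrightarrow> F = G"
  by (simp add: fps_eq_iff)

lemma fps_sparse_ac_scale: "fps_sparse q F \<Longrightarrow> fps_sparse q (fps_ac_scale c F)"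
  unfolding fps_sparse_def by auto

text \<open>The substitution acts on the coefficients of the equation too, and
  \<open>c \<noteq> 0\<close> keeps the equation nontrivial.\<close>

lemma fps_algebraic_ac_scale:
  assumes "fps_algebraic F" "c \<noteq> 0"
  shows "fps_algebraic (fps_ac_scale c F)"
proof -
  obtain P where P: "P \<noteq> 0" "poly (map_poly fps_of_poly P) F = 0"
    using assms(1) unfolding fps_algebraic_def by (elim exE conjE)
  define f where "f q = pcompose (map_poly to_ac q) [:0, c:]" for q
  have coeff_f: "Polynomial.coeff (f q) n = c ^ n * to_ac (Polynomial.coeff q n)" for q n
    unfolding f_def by (simp add: coeff_pcompose_linear coeff_map_poly)
  have f_0: "f q = 0 \<longleftrightarrow> q = 0" for q
    using assms(2) by (simp add: poly_eq_iff coeff_f)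
  have f_scale: "fps_of_poly (f q) = fps_ac_scale c (fps_of_poly q)" for q
    by (simp add: fps_eq_iff coeff_f)
  define Q where "Q = map_poly f P"
  have deg: "Polynomial.degree Q = Polynomial.degree P"
    unfolding Q_def by (rule degree_map_poly) (simp add: f_0)
  have "poly (map_poly fps_of_poly Q) (fps_ac_scale c F) =
      (\<Sum>i\<le>Polynomial.degree P. fps_of_poly (f (Polynomial.coeff P i)) * fps_ac_scale c F ^ i)"
    using deg by (simp add: poly_altdef degree_map_poly coeff_map_poly Q_def f_0)
  also have "\<dots> = fps_ac_scale c (\<Sum>i\<le>Polynomial.degree P. fps_of_poly (Polynomial.coeff P i) * F ^ i)"
    by (simp add: f_scale fps_ac_scale_sum fps_ac_scale_mult fps_ac_scale_power)
  also have "(\<Sum>i\<le>Polynomial.degree P. fps_of_poly (Polynomial.coeff P i) * F ^ i) = 0"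
    using P(2) by (simp add: poly_altdef degree_map_poly coeff_map_poly)
  finally have "poly (map_poly fps_of_poly Q) (fps_ac_scale c F) = 0" by simp
  moreover have "Q \<noteq> 0"
    unfolding Q_def using P(1) by (simp add: map_poly_eq_0_iff f_0)
  ultimately show ?thesis unfolding fps_algebraic_def by blast
qed

lemma fps_sparse_power_card_power:
  fixes F :: "'p::prime_card mod_ring fps"
  shows "fps_sparse (CARD('p) ^ k) (F ^ (CARD('p) ^ k))"
proof (induction k)
  case 0
  show ?case by (simp add: fps_sparse_def)
next
  case (Suc k)
  let ?p = "CARD('p)" and ?G = "F ^ (CARD('p) ^ k)"
  have p: "?p > 0" by simp
  have "fps_sparse (?p ^ Suc k) (?G oo fps_X ^ ?p)"
    unfolding fps_sparse_def
  proof (intro allI impI)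
    fix n assume n: "fps_nth (?G oo fps_X ^ ?p) n \<noteq> 0"
    then have "?p dvd n" "fps_nth ?G (n div ?p) \<noteq> 0"
      unfolding fps_compose_X_power_nth[OF p] by (metis, metis)
    then have "?p ^ k dvd n div ?p" using Suc unfolding fps_sparse_def by blast
    then have "?p * ?p ^ k dvd ?p * (n div ?p)" by (rule mult_dvd_mono[OF dvd_refl])
    then show "?p ^ Suc k dvd n" using \<open>?p dvd n\<close> by simp
  qed
  moreover have "F ^ (?p ^ Suc k) = ?G ^ ?p" by (simp add: mult.commute flip: power_mult)
  ultimately show ?case by (simp only: fps_power_card[of ?G])
qed

lemma fps_reduce_artin_hasse_nth_0_1:
  fixes E :: "'p::prime_card mod_ring fps"
  defines "E \<equiv> fps_reduce (artin_hasse CARD('p))"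
  shows "fps_nth E 0 = 1" "fps_nth E 1 = 1"
proof -
  let ?p = "CARD('p)"
  have p: "?p > 1" using prime_card[where 'a = 'p] by (rule prime_gt_1_nat)
  have log: "fps_nth (artin_hasse ?p) 0 = 1"
      "fps_X * fps_deriv (artin_hasse ?p) = pow_series ?p (\<lambda>_. 1) * artin_hasse ?p"
    using has_logderiv_artin_hasse[OF p] by (auto simp: has_logderiv_def)
  have "fps_nth (artin_hasse ?p) 1 = fps_nth (fps_X * fps_deriv (artin_hasse ?p)) 1"
    by (simp only: fps_X_mult_deriv_nth of_nat_1 mult_1)
  also have "\<dots> = fps_nth (pow_series ?p (\<lambda>_. 1)) (?p ^ 0) * fps_nth (artin_hasse ?p) 0"
    unfolding log(2) using p by (simp add: fps_mult_nth)
  also have "\<dots> = 1" using log(1) p by (simp only: pow_series_nth_power mult_1)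
  finally show "fps_nth E 0 = 1" "fps_nth E 1 = 1"
    using log(1) by (simp_all add: E_def fps_reduce_def)
qed

text \<open>
  The exponent is the p-adic integer with digits b, and the last hypothesis is a quantitative
  form of its irrationality.
\<close>

lemma artin_hasse_transcendental_if_irrational_power:
  fixes E :: "'p::prime_card mod_ring fps"
  defines "p \<equiv> CARD('p)" and "E \<equiv> fps_reduce (artin_hasse CARD('p))"
  assumes prod: "fps_ac_scale 1 (fps_reduce (artin_hasse_power p b)) =
                   (\<Prod>c\<leftarrow>L. fps_ac_scale c E)"
    and L: "0 \<notin> set L"
    and irr: "\<And>m. \<exists>J. \<forall>x y. \<bar>x\<bar> \<le> int m \<longrightarrow> \<bar>y\<bar> \<le> int m \<longrightarrow>
                int (p ^ Suc J) dvd x + y * int (digit_sum p b J) \<longrightarrow> x = 0 \<and> y = 0"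
  shows "fps_transcendental E"
proof
  assume alg: "fps_algebraic E"
  define F where "F = fps_ac_scale 1 E"
  define G where "G = (\<Prod>c\<leftarrow>L. fps_ac_scale c E)"
  have "fps_algebraic F" "\<And>f. f \<in> set (map (\<lambda>c. fps_ac_scale c E) L) \<Longrightarrow> fps_algebraic f"
    using alg L by (auto simp: F_def intro!: fps_algebraic_ac_scale)
  from algebraic_imp_monomials_dependent[OF this] obtain m c i j where
    dep: "(\<Sum>(i,j)\<in>{..m}\<times>{..m}. fps_const (c (i, j)) * (F ^ i * G ^ j)) = 0"
    and ij: "i \<le> m" "j \<le> m" "c (i, j) \<noteq> 0"
    unfolding G_def by blast
  obtain J where J: "\<And>x y. \<bar>x\<bar> \<le> int m \<Longrightarrow> \<bar>y\<bar> \<le> int m \<Longrightarrow>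
      int (p ^ Suc J) dvd x + y * int (digit_sum p b J) \<Longrightarrow> x = 0 \<and> y = 0"
    using irr[of m] by blast
  define q where "q = p ^ Suc J"
  define t where "t = digit_sum p b J"
  have "q > 0" unfolding q_def p_def by simp
  have F_nth: "fps_nth F 0 = 1" "fps_nth F 1 \<noteq> 0"
    using fps_reduce_artin_hasse_nth_0_1[where 'p = 'p] by (simp_all add: F_def E_def)
  define W where "W = (fps_reduce (artin_hasse_power p (\<lambda>i. b (i + Suc J))) :: 'p mod_ring fps)"
  define V where "V = fps_ac_scale 1 (W ^ q)"
  have G_eq: "G = F ^ t * V"
  proof -
    have "fps_reduce (artin_hasse_power p b) = E ^ t * W ^ q"
      unfolding E_def t_def W_def q_def p_def by (rule fps_reduce_artin_hasse_power_eq)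
    with prod show ?thesis
      by (simp add: G_def F_def V_def fps_ac_scale_mult fps_ac_scale_power)
  qed
  have V: "fps_sparse q V"
    unfolding V_def q_def p_def by (intro fps_sparse_ac_scale fps_sparse_power_card_power)
  have F_q: "fps_sparse q (F ^ q)"
    unfolding F_def fps_ac_scale_power[symmetric] q_def p_def
    by (intro fps_sparse_ac_scale fps_sparse_power_card_power)
  have "fps_nth G 0 = 1"
  proof -
    have "fps_nth E 0 = 1"
      unfolding E_def by (rule fps_reduce_artin_hasse_nth_0_1)
    then show ?thesis unfolding G_def by (induction L) auto
  qed
  then have "V \<noteq> 0" unfolding G_eq by auto
  \<comment> \<open>As \<open>F ^ i * G ^ j = F ^ (i + j * t) * V ^ j\<close>, dividing the exponent
    by \<open>q\<close> moves the quotient into a sparse factor and leaves the remainder as the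
    exponent of \<open>F\<close>.\<close>
  define r where "r = (\<lambda>(i, j). (i + j * t) mod q)"
  define u where "u = (\<lambda>(i, j). (F ^ q) ^ ((i + j * t) div q) * V ^ j)"
  have monomial: "F ^ i * G ^ j = F ^ r (i, j) * u (i, j)" for i j
  proof -
    have "F ^ i * G ^ j = F ^ (i + j * t) * V ^ j"
      by (simp add: G_eq power_mult_distrib power_add mult.commute[of j] flip: power_mult)
    also have "F ^ (i + j * t) = F ^ r (i, j) * (F ^ q) ^ ((i + j * t) div q)"
      by (simp add: r_def flip: power_mult power_add)
    finally show ?thesis by (simp add: u_def mult_ac)
  qed
  have "c (i, j) = 0"
  proof (rule twisted_powers_independent[OF F_nth, where c = c and r = r and u = u and q = q
        and i = "(i, j)" and I = "{..m} \<times> {..m}"])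
    \<comment> \<open>Equal remainders make \<open>q\<close> divide (i - i') + (j - j') t with both
      differences bounded by \<open>m\<close>; this is what \<open>J\<close> was chosen to
      exclude.\<close>
    show "inj_on r ({..m} \<times> {..m})"
    proof (rule inj_onI)
      fix x y assume xy: "x \<in> {..m} \<times> {..m}" "y \<in> {..m} \<times> {..m}" "r x = r y"
      obtain i j i' j' where eqs: "x = (i, j)" "y = (i', j')" by (cases x, cases y)
      have "[i + j * t = i' + j' * t] (mod q)" using xy(3) by (simp add: eqs r_def cong_def)
      then have "[int (i + j * t) = int (i' + j' * t)] (mod int q)" by (simp only: cong_int_iff)
      then have "int q dvd int (i + j * t) - int (i' + j' * t)" by (simp only: cong_iff_dvd_diff)
      then have "int (p ^ Suc J) dvd (int i - int i') + (int j - int j') * int (digit_sum p b J)"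
        by (simp add: q_def t_def algebra_simps)
      with xy(1,2) have "int i - int i' = 0 \<and> int j - int j' = 0"
        by (intro J) (auto simp: eqs)
      then show "x = y" by (simp add: eqs)
    qed
    show "r x < q" for x using \<open>q > 0\<close> by (cases x) (simp add: r_def)
    show "fps_sparse q (u x)" for x
      by (cases x) (auto simp: u_def intro!: fps_sparse_mult fps_sparse_power F_q V)
    show "u x \<noteq> 0" for x
      using \<open>V \<noteq> 0\<close> F_nth by (cases x) (auto simp: u_def)
    show "(\<Sum>x\<in>{..m} \<times> {..m}. fps_const (c x) * (F ^ r x * u x)) = 0"
      using dep unfolding monomial by (simp add: case_prod_unfold)
  qed (use ij in auto)
  with ij show False by simp
qed

text \<open>The digits are the successive differences divided by \<open>p ^ Suc i\<close>. They may
  exceed \<open>p\<close>, but they are natural numbers, hence the monotonicity of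
  \<open>t\<close>.\<close>

lemma exists_digit_sum_eq:
  assumes "\<And>i. t i \<le> t (Suc i)" "\<And>i. int p ^ Suc i dvd int (t (Suc i)) - int (t i)"
  shows "\<exists>b. \<forall>i. digit_sum p b i = t i"
proof (intro exI allI)
  define b where "b i = (case i of 0 \<Rightarrow> t 0 | Suc i \<Rightarrow> (t (Suc i) - t i) div p ^ Suc i)" for i
  fix i
  show "digit_sum p b i = t i"
  proof (induction i)
    case (Suc i)
    have "int (p ^ Suc i) dvd int (t (Suc i) - t i)"
      using assms(1)[of i] assms(2)[of i] by (simp add: of_nat_diff)
    then have "p ^ Suc i dvd t (Suc i) - t i" by (simp only: int_dvd_int_iff)
    then have "b (Suc i) * p ^ Suc i = t (Suc i) - t i" by (simp add: b_def del: power_Suc)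
    then show ?case using Suc assms(1)[of i] by (simp add: digit_sum_Suc del: power_Suc)
  qed (simp add: b_def)
qed

section \<open>Products of scalings in characteristic zero\<close>

lemma has_logderiv_ac_scale:
  "has_logderiv F l \<Longrightarrow> has_logderiv (fps_ac_scale c F) (fps_ac_scale c l)"
proof -
  assume F: "has_logderiv F l"
  have "fps_X * fps_deriv (fps_ac_scale c F) = fps_ac_scale c (fps_X * fps_deriv F)"
    by (rule fps_ext) (simp add: fps_X_mult_deriv_nth del: fps_X_mult_nth)
  with F show ?thesis by (simp add: has_logderiv_def fps_ac_scale_mult)
qed

lemma fps_ac_scale_pow_series:
  "p > 1 \<Longrightarrow> fps_ac_scale c (pow_series p t) = pow_series p (\<lambda>i. c ^ (p ^ i) * to_ac (t i))"
  by (rule fps_eq_pow_seriesI) (auto simp: pow_series_nth_eq_0)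

text \<open>The logarithmic derivative of E(cx) has coefficient c^(p^i) at x^(p^i), so only the
  power sums of \<open>L\<close> matter; the members of \<open>L\<close> themselves may be
  irrational.\<close>

lemma artin_hasse_power_eq_prod_scale:
  assumes "p > 1" "\<And>i. (\<Sum>c\<leftarrow>L. c ^ (p ^ i)) = of_nat (digit_sum p b i)"
  shows "fps_ac_scale 1 (artin_hasse_power p b) = (\<Prod>c\<leftarrow>L. fps_ac_scale c (artin_hasse p))"
proof (rule has_logderiv_unique)
  show "has_logderiv (fps_ac_scale 1 (artin_hasse_power p b))
          (pow_series p (\<lambda>i. of_nat (digit_sum p b i)))"
    using has_logderiv_ac_scale[OF has_logderiv_artin_hasse_power[OF assms(1), of b], of 1] assms(1)
    by (simp add: fps_ac_scale_pow_series)
  have "has_logderiv (\<Prod>c\<leftarrow>L. fps_ac_scale c (artin_hasse p)) (pow_series p (\<lambda>i. \<Sum>c\<leftarrow>L. c ^ (p ^ i)))"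
  proof (induction L)
    case Nil
    have "pow_series p (\<lambda>_. 0) = (0 :: rat alg_closure fps)"
      by (simp add: fps_eq_iff pow_series_def)
    then show ?case by (simp add: has_logderiv_1)
  next
    case (Cons c L)
    have "has_logderiv (fps_ac_scale c (artin_hasse p)) (pow_series p (\<lambda>i. c ^ (p ^ i)))"
      using has_logderiv_ac_scale[OF has_logderiv_artin_hasse[OF assms(1)], of c] assms(1)
      by (simp add: fps_ac_scale_pow_series)
    from has_logderiv_mult[OF this Cons] show ?case by (simp add: pow_series_add)
  qed
  then show "has_logderiv (\<Prod>c\<leftarrow>L. fps_ac_scale c (artin_hasse p))
               (pow_series p (\<lambda>i. of_nat (digit_sum p b i)))"
    by (simp only: assms(2))
qed

section \<open>Primes larger than three\<close>

text \<open>\<open>2 ^ (p ^ J)\<close> approximates a root of unity of order dividing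
  \<open>p - 1\<close>. Raising x = -y t to the power \<open>p - 1\<close> gives |x| = |y|, so for y
  nonzero t would behave like 1 or -1, whereas it is congruent to 2 modulo \<open>p\<close>.\<close>

lemma two_power_irrational:
  assumes "prime p" "p > 3"
  shows "\<exists>J. \<forall>x y. \<bar>x\<bar> \<le> int m \<longrightarrow> \<bar>y\<bar> \<le> int m \<longrightarrow>
           int (p ^ Suc J) dvd x + y * int (2 ^ (p ^ J)) \<longrightarrow> x = 0 \<and> y = 0"
proof -
  \<comment> \<open>Chosen to make \<open>q\<close> exceed both \<open>m\<close> and
    \<open>m ^ (p - 1)\<close>, so that congruences modulo \<open>q\<close> between numbers of this
    size are equalities.\<close>
  define J where "J = m ^ (p - 1) + m"
  define q where "q = int (p ^ Suc J)"
  define t where "t = int (2 ^ (p ^ J))"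
  have "odd p" using assms prime_odd_nat by auto
  have "coprime 2 p" using \<open>odd p\<close> by simp
  have "J < p ^ Suc J" using assms(2) by (intro less_trans[OF lessI power_gt_expt]) auto
  then have q: "int m < q" "int m ^ (p - 1) < q"
    unfolding q_def J_def by (simp_all only: of_nat_less_iff of_nat_power[symmetric])
  have "[2 ^ totient (p ^ Suc J) = 1] (mod p ^ Suc J)"
    using \<open>coprime 2 p\<close> by (intro euler_theorem) simp
  also have "totient (p ^ Suc J) = p ^ J * (p - 1)"
    using assms(1) by (rule totient_prime_power_Suc)
  finally have "[int ((2 ^ (p ^ J)) ^ (p - 1)) = int 1] (mod int (p ^ Suc J))"
    by (simp only: cong_int_iff power_mult)
  then have t_pow: "[t ^ (p - 1) = 1] (mod q)" by (simp add: t_def q_def)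
  have fermat: "[2 ^ (p ^ k) = 2] (mod p)" for k
  proof (induction k)
    case (Suc k)
    have "[2 ^ (p - 1) * 2 = 1 * 2] (mod p)"
      using \<open>coprime 2 p\<close> assms by (intro cong_mult fermat_theorem) (auto simp: coprime_commute prime_imp_coprime dest: dvd_imp_le)
    then have "[2 ^ p = 2] (mod p)" using assms(2) by (simp flip: power_Suc2)
    moreover have "[(2 ^ (p ^ k)) ^ p = 2 ^ p] (mod p)" by (intro cong_pow Suc)
    ultimately show ?case by (simp add: mult.commute cong_trans flip: power_mult)
  qed simp
  have "[int (2 ^ (p ^ J)) = int 2] (mod int p)" using fermat[of J] by (simp only: cong_int_iff)
  then have t_mod: "[t = 2] (mod int p)" by (simp add: t_def)
  have "x = 0 \<and> y = 0" if xy: "\<bar>x\<bar> \<le> int m" "\<bar>y\<bar> \<le> int m" "q dvd x + y * t" for x y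
  proof -
    have even: "even (p - 1)" using \<open>odd p\<close> by simp
    have "[x = - (y * t)] (mod q)" using xy(3) by (simp add: cong_iff_dvd_diff)
    then have "[x ^ (p - 1) = (- (y * t)) ^ (p - 1)] (mod q)" by (rule cong_pow)
    also have "(- (y * t)) ^ (p - 1) = y ^ (p - 1) * t ^ (p - 1)"
      using even by (simp add: power_mult_distrib)
    also have "[y ^ (p - 1) * t ^ (p - 1) = y ^ (p - 1) * 1] (mod q)"
      by (intro cong_mult t_pow) simp
    finally have "q dvd x ^ (p - 1) - y ^ (p - 1)" by (simp add: cong_iff_dvd_diff)
    moreover have "\<bar>z\<bar> ^ (p - 1) \<le> int m ^ (p - 1)" if "\<bar>z\<bar> \<le> int m" for z
      using that by (intro power_mono) auto
    from this[OF xy(1)] this[OF xy(2)] have "\<bar>x ^ (p - 1) - y ^ (p - 1)\<bar> < q"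
      using q(2) even zero_le_even_power[OF even, of x] zero_le_even_power[OF even, of y]
      by (simp add: power_even_abs abs_less_iff)
    ultimately have "x ^ (p - 1) = y ^ (p - 1)"
      using zdvd_imp_le[of q "\<bar>x ^ (p - 1) - y ^ (p - 1)\<bar>"] by fastforce
    then have "\<bar>x\<bar> ^ (p - 1) = \<bar>y\<bar> ^ (p - 1)" using even by (simp add: power_even_abs)
    then have "\<bar>x\<bar> = \<bar>y\<bar>" using assms(2) by (simp add: power_eq_iff_eq_base)
    then obtain e where e: "x = e * y" "e = 1 \<or> e = -1" by (metis abs_eq_iff mult_1 mult_minus1)
    \<comment> \<open>Modulo \<open>p\<close> this is \<open>e + 2\<close>, that is 3 or 1; here
      \<open>p > 3\<close> is decisive.\<close>
    have "\<not> int p dvd e + t"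
    proof
      assume "int p dvd e + t"
      moreover have "int p dvd t - 2" using t_mod by (simp add: cong_iff_dvd_diff)
      ultimately have "int p dvd (e + t) - (t - 2)" by (rule dvd_diff)
      then have "int p dvd e + 2" by (simp add: algebra_simps)
      then have "int p \<le> e + 2" using e(2) by (intro zdvd_imp_le) auto
      then show False using e(2) assms(2) by auto
    qed
    then have "coprime q (e + t)"
      unfolding q_def using assms(1) by (simp add: prime_imp_coprime coprime_power_left_iff del: power_Suc)
    moreover have "q dvd y * (e + t)" using xy(3) e(1) by (simp add: algebra_simps)
    ultimately have "q dvd y" by (simp add: coprime_dvd_mult_left_iff)
    then have "y = 0" using xy(2) q(1) zdvd_imp_le[of q "\<bar>y\<bar>"] by fastforce
    with e(1) show ?thesis by simp
  qed
  then show ?thesis unfolding q_def t_def by blast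
qed

text \<open>The digit sums are \<open>2 ^ (p ^ i)\<close>. Their compatibility is Euler's theorem,
  since consecutive exponents of 2 differ by the totient of \<open>p ^ Suc i\<close>.\<close>

lemma artin_hasse_transcendental_large_prime:
  assumes "CARD('p::prime_card) > 3"
  shows "fps_transcendental (fps_reduce (artin_hasse CARD('p)) :: 'p mod_ring fps)"
proof -
  define p where "p = CARD('p)"
  have p: "prime p" "p > 3" "p > 1"
    unfolding p_def using prime_card[where 'a = 'p] assms prime_gt_1_nat by blast+
  define t where "t i = (2 :: nat) ^ (p ^ i)" for i
  have "coprime 2 p" using p(1,2) prime_odd_nat[of p] by simp
  have t_dvd: "int p ^ Suc i dvd int (t (Suc i)) - int (t i)" for i
  proof -
    have "[2 ^ totient (p ^ Suc i) = 1] (mod p ^ Suc i)"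
      using \<open>coprime 2 p\<close> by (intro euler_theorem) simp
    also have "totient (p ^ Suc i) = p ^ i * (p - 1)"
      using p(1) by (rule totient_prime_power_Suc)
    finally have "[t i * 2 ^ (p ^ i * (p - 1)) = t i * 1] (mod p ^ Suc i)"
      by (intro cong_mult) auto
    also have "t i * 2 ^ (p ^ i * (p - 1)) = t (Suc i)"
    proof -
      have "p ^ i + p ^ i * (p - 1) = p ^ Suc i" using p(3) by (cases p) auto
      then show ?thesis unfolding t_def by (simp only: power_add[symmetric])
    qed
    finally have "[int (t (Suc i)) = int (t i)] (mod int (p ^ Suc i))"
      by (simp only: cong_int_iff mult_1_right)
    then show ?thesis by (simp only: cong_iff_dvd_diff of_nat_power)
  qed
  have "t i \<le> t (Suc i)" for i
    unfolding t_def using p by (intro power_increasing) auto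
  with t_dvd obtain b where b: "\<And>i. digit_sum p b i = t i" using exists_digit_sum_eq by blast
  have scale: "fps_ac_scale 1 (artin_hasse_power p b) = (\<Prod>c\<leftarrow>[2]. fps_ac_scale c (artin_hasse p))"
    by (rule artin_hasse_power_eq_prod_scale[OF p(3)]) (simp add: b t_def)
  \<comment> \<open>Both sides are rational, so the identity descends from the algebraic closure and
    can be reduced coefficientwise.\<close>
  have coeff: "fps_nth (artin_hasse_power p b) n = of_int (2 ^ n) * fps_nth (artin_hasse p) n" for n
  proof -
    have "to_ac (fps_nth (artin_hasse_power p b) n) = to_ac (of_int (2 ^ n) * fps_nth (artin_hasse p) n)"
      using arg_cong[OF scale, of "\<lambda>F. fps_nth F n"] by simp
    then show ?thesis by (simp only: to_ac_eq_iff)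
  qed
  have int: "p_integral p (fps_nth (artin_hasse p) n)" for n
    using p_integral_artin_hasse[where 'p = 'p] by (simp add: p_integral_fps_def p_def)
  have "fps_ac_scale 1 (fps_reduce (artin_hasse_power p b) :: 'p mod_ring fps) =
      (\<Prod>c\<leftarrow>[2]. fps_ac_scale c (fps_reduce (artin_hasse p)))"
  proof (rule fps_ext)
    fix n
    have "(rat_reduce (of_int (2 ^ n) * fps_nth (artin_hasse p) n) :: 'p mod_ring) =
        rat_reduce (of_int (2 ^ n)) * rat_reduce (fps_nth (artin_hasse p) n)"
      by (rule rat_reduce_mult) (use int p in \<open>simp_all only: p_def[symmetric] p_integral_of_int\<close>)
    also have "(rat_reduce (of_int (2 ^ n)) :: 'p mod_ring) = 2 ^ n"
      by (simp only: rat_reduce_of_int) simp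
    finally show "fps_nth (fps_ac_scale 1 (fps_reduce (artin_hasse_power p b) :: 'p mod_ring fps)) n =
        fps_nth (\<Prod>c\<leftarrow>[2]. fps_ac_scale c (fps_reduce (artin_hasse p))) n"
      by (simp add: fps_reduce_def coeff del: of_int_power)
  qed
  moreover have "0 \<notin> set [2 :: 'p mod_ring alg_closure]"
  proof -
    have "\<not> p dvd 2" using p(2) by (auto dest: dvd_imp_le)
    then have "(of_nat 2 :: 'p mod_ring alg_closure) \<noteq> 0"
      by (simp only: of_nat_eq_0_iff_char_dvd CHAR_alg_closure semiring_char_mod_ring p_def
          not_False_eq_True)
    then show ?thesis by simp
  qed
  ultimately show ?thesis
    unfolding p_def
    by (rule artin_hasse_transcendental_if_irrational_power)
       (use two_power_irrational[OF p(1,2)] b in \<open>simp only: p_def[symmetric] t_def\<close>)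
qed

section \<open>The primes two and three\<close>

text \<open>
  Here no root of unity in the prime field has an irrational Teichmueller lift, so roots of
  X^3 - X^2 - 1 in the algebraic closure are used instead: the sum of their Teichmueller lifts
  is a root of X^2 + (p - 1) X + p.
\<close>

lemma cubic_roots_exist:
  "\<exists>l1 l2 l3 :: 'a::alg_closed_field.
     l1 + l2 + l3 = 1 \<and> l1 * l2 + l1 * l3 + l2 * l3 = 0 \<and> l1 * l2 * l3 = 1"
proof -
  obtain l1 :: 'a where "poly [:-1, 0, -1, 1:] l1 = 0"
    using alg_closed_imp_poly_has_root[of "[:-1, 0, -1, 1 :: 'a:]"] by auto
  then have l1: "l1 ^ 3 = l1 ^ 2 + 1" by (simp add: algebra_simps power2_eq_square power3_eq_cube)
  \<comment> \<open>The quadratic is the quotient of the cubic by X - l1; the third root is then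
    forced by the sum of the roots.\<close>
  obtain l2 where "poly [:l1 ^ 2 - l1, l1 - 1, 1:] l2 = 0"
    using alg_closed_imp_poly_has_root[of "[:l1 ^ 2 - l1, l1 - 1, 1:]"] by auto
  then have l2: "l2 ^ 2 + (l1 - 1) * l2 + l1 ^ 2 - l1 = 0"
    by (simp add: algebra_simps power2_eq_square)
  have "l1 + l2 + (1 - l1 - l2) = 1" by simp
  moreover have "l1 * l2 + l1 * (1 - l1 - l2) + l2 * (1 - l1 - l2) = 0"
  proof -
    have "l1 * l2 + l1 * (1 - l1 - l2) + l2 * (1 - l1 - l2) = - (l2 ^ 2 + (l1 - 1) * l2 + l1 ^ 2 - l1)"
      by (simp add: algebra_simps power2_eq_square)
    then show ?thesis using l2 by simp
  qed
  moreover have "l1 * l2 * (1 - l1 - l2) = 1"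
  proof -
    have "l1 * l2 * (1 - l1 - l2) =
        l1 ^ 3 - l1 ^ 2 - l1 * (l2 ^ 2 + (l1 - 1) * l2 + l1 ^ 2 - l1)"
      by (simp add: algebra_simps power2_eq_square power3_eq_cube)
    then show ?thesis using l1 l2 by simp
  qed
  ultimately show ?thesis by blast
qed

lemma cubic_root_cube:
  fixes l1 l2 l3 :: "'a::comm_ring_1"
  assumes "l1 + l2 + l3 = 1" "l1 * l2 + l1 * l3 + l2 * l3 = 0" "l1 * l2 * l3 = 1"
  shows "l1 ^ 3 = l1 ^ 2 + 1" "l2 ^ 3 = l2 ^ 2 + 1" "l3 ^ 3 = l3 ^ 2 + 1"
proof -
  have "x ^ 3 = (x + y + z) * x ^ 2 - (x * y + x * z + y * z) * x + x * y * z" for x y z :: 'a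
    by (simp add: algebra_simps power2_eq_square power3_eq_cube)
  from this[of l1 l2 l3] this[of l2 l1 l3] this[of l3 l1 l2]
  show "l1 ^ 3 = l1 ^ 2 + 1" "l2 ^ 3 = l2 ^ 2 + 1" "l3 ^ 3 = l3 ^ 2 + 1"
    using assms by (simp_all add: ac_simps)
qed

text \<open>Coordinates of X^n in the basis 1, X, X^2 modulo X^3 - X^2 - 1. Being integers, they
  make sense in every characteristic.\<close>

fun cubic_coeffs :: "nat \<Rightarrow> int \<times> int \<times> int" where
  "cubic_coeffs 0 = (1, 0, 0)"
| "cubic_coeffs (Suc n) = (case cubic_coeffs n of (a, b, c) \<Rightarrow> (c, a, b + c))"

lemma cubic_root_power:
  fixes l :: "'a::comm_ring_1"
  assumes "l ^ 3 = l ^ 2 + 1" "cubic_coeffs n = (a, b, c)"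
  shows "l ^ n = of_int a + of_int b * l + of_int c * l ^ 2"
  using assms(2)
proof (induction n arbitrary: a b c)
  case (Suc n)
  obtain a' b' c' where eq: "cubic_coeffs n = (a', b', c')" by (cases "cubic_coeffs n")
  with Suc.prems have abc: "a = c'" "b = a'" "c = b' + c'" by auto
  have "l ^ Suc n = l * (of_int a' + of_int b' * l + of_int c' * l ^ 2)"
    using Suc.IH[OF eq] by simp
  also have "\<dots> = of_int a' * l + of_int b' * l ^ 2 + of_int c' * l ^ 3"
    by (simp add: algebra_simps power2_eq_square power3_eq_cube)
  finally show ?case using assms(1) by (simp add: abc algebra_simps)
qed auto

text \<open>The power sums of the three roots by Newton's recurrence, as natural numbers because
  they will serve as digit sums.\<close>

fun cubic_power_sum :: "nat \<Rightarrow> nat" where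
  "cubic_power_sum 0 = 3"
| "cubic_power_sum (Suc 0) = 1"
| "cubic_power_sum (Suc (Suc 0)) = 1"
| "cubic_power_sum (Suc (Suc (Suc n))) = cubic_power_sum (Suc (Suc n)) + cubic_power_sum n"

lemma cubic_power_sum_eq:
  fixes l1 l2 l3 :: "'a::comm_ring_1"
  assumes "l1 + l2 + l3 = 1" "l1 * l2 + l1 * l3 + l2 * l3 = 0" "l1 * l2 * l3 = 1"
  shows "l1 ^ n + l2 ^ n + l3 ^ n = of_nat (cubic_power_sum n)"
proof (induction n rule: cubic_power_sum.induct)
  case 3
  have "l1 ^ 2 + l2 ^ 2 + l3 ^ 2 = (l1 + l2 + l3) ^ 2 - 2 * (l1 * l2 + l1 * l3 + l2 * l3)"
    by (simp add: algebra_simps power2_eq_square)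
  then show ?case using assms(1,2) by (simp add: power2_eq_square)
next
  case (4 n)
  have "l ^ Suc (Suc (Suc n)) = l ^ Suc (Suc n) + l ^ n" if "l ^ 3 = l ^ 2 + 1" for l :: 'a
  proof -
    have "l ^ Suc (Suc (Suc n)) = l ^ n * l ^ 3" by (simp add: power3_eq_cube mult_ac)
    also have "\<dots> = l ^ Suc (Suc n) + l ^ n"
      unfolding that by (simp add: algebra_simps power2_eq_square)
    finally show ?thesis .
  qed
  note rec = cubic_root_cube[OF assms, THEN this]
  show ?case unfolding rec using 4 by (simp add: algebra_simps del: power_Suc)
qed (use assms in auto)

text \<open>The index 0 is excluded because its value 3 exceeds the next ones; only powers of
  \<open>p\<close> occur as indices later.\<close>

lemma cubic_power_sum_mono: "1 \<le> m \<Longrightarrow> m \<le> n \<Longrightarrow> cubic_power_sum m \<le> cubic_power_sum n"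
proof -
  have "cubic_power_sum (Suc n) \<le> cubic_power_sum (Suc (Suc n))" for n
    by (cases n) auto
  then have "incseq (\<lambda>n. cubic_power_sum (Suc n))" by (rule incseq_SucI)
  then show "1 \<le> m \<Longrightarrow> m \<le> n \<Longrightarrow> cubic_power_sum m \<le> cubic_power_sum n"
    using incseqD[of "\<lambda>n. cubic_power_sum (Suc n)" "m - 1" "n - 1"] by simp
qed

text \<open>
  The first two elementary symmetric functions of the p^i-th powers of the three roots, for
  p = 2 and for p = 3.
\<close>

fun cubic_sym2 :: "nat \<Rightarrow> int \<times> int" where
  "cubic_sym2 0 = (1, 0)"
| "cubic_sym2 (Suc i) = (case cubic_sym2 i of (t, s) \<Rightarrow> (t ^ 2 - 2 * s, s ^ 2 - 2 * t))"

fun cubic_sym3 :: "nat \<Rightarrow> int \<times> int" where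
  "cubic_sym3 0 = (1, 0)"
| "cubic_sym3 (Suc i) = (case cubic_sym3 i of (t, s) \<Rightarrow>
     (t ^ 3 - 3 * t * s + 3, s ^ 3 - 3 * t * s + 3))"

text \<open>The product of the roots stays 1 under squaring, so the first two symmetric functions
  determine their successors.\<close>

lemma cubic_sym2_eq:
  fixes l1 l2 l3 :: "'a::comm_ring_1"
  assumes l: "l1 + l2 + l3 = 1" "l1 * l2 + l1 * l3 + l2 * l3 = 0" "l1 * l2 * l3 = 1"
    and "cubic_sym2 i = (t, s)"
  defines "x \<equiv> l1 ^ 2 ^ i" and "y \<equiv> l2 ^ 2 ^ i" and "z \<equiv> l3 ^ 2 ^ i"
  shows "x + y + z = of_int t \<and> x * y + x * z + y * z = of_int s"
  using assms(4) unfolding x_def y_def z_def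
proof (induction i arbitrary: t s)
  case (Suc i)
  obtain t' s' where eq: "cubic_sym2 i = (t', s')" by (cases "cubic_sym2 i")
  define x y z where xyz: "x = l1 ^ 2 ^ i" "y = l2 ^ 2 ^ i" "z = l3 ^ 2 ^ i"
  have IH: "x + y + z = of_int t'" "x * y + x * z + y * z = of_int s'"
    using Suc.IH[OF eq] by (auto simp: xyz)
  have prod: "x * y * z = 1" using l(3) unfolding xyz by (simp flip: power_mult_distrib)
  have ts: "t = t' ^ 2 - 2 * s'" "s = s' ^ 2 - 2 * t'" using Suc.prems eq by auto
  have "x\<^sup>2 + y\<^sup>2 + z\<^sup>2 = (x + y + z)\<^sup>2 - 2 * (x * y + x * z + y * z)"
    "x\<^sup>2 * y\<^sup>2 + x\<^sup>2 * z\<^sup>2 + y\<^sup>2 * z\<^sup>2 =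
       (x * y + x * z + y * z)\<^sup>2 - 2 * (x + y + z) * (x * y * z)"
    by (simp_all add: algebra_simps power2_eq_square)
  then have "x\<^sup>2 + y\<^sup>2 + z\<^sup>2 = of_int t" "x\<^sup>2 * y\<^sup>2 + x\<^sup>2 * z\<^sup>2 + y\<^sup>2 * z\<^sup>2 = of_int s"
    unfolding prod IH ts by simp_all
  moreover have "l ^ 2 ^ Suc i = (l ^ 2 ^ i)\<^sup>2" for l :: 'a
    by (simp add: mult.commute flip: power_mult)
  ultimately show ?case by (simp add: xyz)
qed (use l in auto)

lemma cubic_sym3_eq:
  fixes l1 l2 l3 :: "'a::comm_ring_1"
  assumes l: "l1 + l2 + l3 = 1" "l1 * l2 + l1 * l3 + l2 * l3 = 0" "l1 * l2 * l3 = 1"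
    and "cubic_sym3 i = (t, s)"
  defines "x \<equiv> l1 ^ 3 ^ i" and "y \<equiv> l2 ^ 3 ^ i" and "z \<equiv> l3 ^ 3 ^ i"
  shows "x + y + z = of_int t \<and> x * y + x * z + y * z = of_int s"
  using assms(4) unfolding x_def y_def z_def
proof (induction i arbitrary: t s)
  case (Suc i)
  obtain t' s' where eq: "cubic_sym3 i = (t', s')" by (cases "cubic_sym3 i")
  define x y z where xyz: "x = l1 ^ 3 ^ i" "y = l2 ^ 3 ^ i" "z = l3 ^ 3 ^ i"
  have IH: "x + y + z = of_int t'" "x * y + x * z + y * z = of_int s'"
    using Suc.IH[OF eq] by (auto simp: xyz)
  have prod: "x * y * z = 1" using l(3) unfolding xyz by (simp flip: power_mult_distrib)
  have ts: "t = t' ^ 3 - 3 * t' * s' + 3" "s = s' ^ 3 - 3 * t' * s' + 3" using Suc.prems eq by auto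
  have "x ^ 3 + y ^ 3 + z ^ 3 =
      (x + y + z) ^ 3 - 3 * (x + y + z) * (x * y + x * z + y * z) + 3 * (x * y * z)"
    "x ^ 3 * y ^ 3 + x ^ 3 * z ^ 3 + y ^ 3 * z ^ 3 = (x * y + x * z + y * z) ^ 3
       - 3 * (x + y + z) * (x * y + x * z + y * z) * (x * y * z) + 3 * (x * y * z)\<^sup>2"
    by (simp_all add: algebra_simps power2_eq_square power3_eq_cube)
  then have "x ^ 3 + y ^ 3 + z ^ 3 = of_int t" "x ^ 3 * y ^ 3 + x ^ 3 * z ^ 3 + y ^ 3 * z ^ 3 = of_int s"
    unfolding prod IH ts by simp_all
  moreover have "l ^ 3 ^ Suc i = (l ^ 3 ^ i) ^ 3" for l :: 'a
    by (simp add: mult.commute flip: power_mult)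
  ultimately show ?case by (simp add: xyz)
qed (use l in auto)

text \<open>Modulo 2 the roots have order 7. With zeta a 7th root of unity, \<open>t\<close> and
  \<open>s\<close> tend to the periods zeta + zeta^2 + zeta^4 and zeta^3 + zeta^5 + zeta^6, whose
  sum is -1 and whose product is 2. Each step gains a factor 2, and the third congruence combines
  the first two.\<close>

lemma cubic_sym2_cong:
  assumes "cubic_sym2 i = (t, s)"
  shows "2 ^ Suc i dvd s + t + 1 \<and> 2 ^ Suc i dvd t ^ 2 + t + 2 \<and>
         2 ^ Suc i dvd fst (cubic_sym2 (Suc i)) - t"
  using assms
proof (induction i arbitrary: t s)
  case (Suc i)
  obtain t' s' where eq: "cubic_sym2 i = (t', s')" by (cases "cubic_sym2 i")
  have ts: "t = t' ^ 2 - 2 * s'" "s = s' ^ 2 - 2 * t'" using Suc.prems eq by auto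
  obtain u where u: "s' + t' + 1 = 2 ^ Suc i * u" using Suc.IH[OF eq] by (auto elim!: dvdE)
  obtain v where v: "t' ^ 2 + t' + 2 = 2 ^ Suc i * v" using Suc.IH[OF eq] by (auto elim!: dvdE)
  define q :: int where "q = 2 ^ i"
  have uv: "s' = 2 * q * u - t' - 1" "t' ^ 2 + t' + 2 = 2 * q * v"
    using u v by (auto simp: q_def)
  have "s + t + 1 = 4 * q * (q * u ^ 2 - u * (t' + 2)) + 2 * (t' ^ 2 + t' + 2)"
    unfolding ts uv(1) by (simp add: algebra_simps power2_eq_square)
  then have 1: "s + t + 1 = 4 * q * (q * u ^ 2 - u * (t' + 2) + v)"
    unfolding uv(2) by (simp add: algebra_simps)
  have "t = t' + (t' ^ 2 + t' + 2) - 4 * q * u"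
    unfolding ts uv(1) by (simp add: algebra_simps)
  then have t_eq: "t = t' + 2 * q * (v - 2 * u)"
    unfolding uv(2) by (simp add: algebra_simps)
  have "t ^ 2 + t + 2 = (t' ^ 2 + t' + 2) + 2 * q * (v - 2 * u) * (2 * t' + 1) + (2 * q * (v - 2 * u)) ^ 2"
    unfolding t_eq by (simp add: algebra_simps power2_eq_square)
  then have 2: "t ^ 2 + t + 2 = 4 * q * (v * (t' + 1) + q * (v - 2 * u) ^ 2 - u * (2 * t' + 1))"
    unfolding uv(2) by (simp add: algebra_simps power2_eq_square)
  have t_s: "fst (cubic_sym2 (Suc (Suc i))) = t ^ 2 - 2 * s" using Suc.prems by simp
  have 3: "t ^ 2 - 2 * s - t = (t ^ 2 + t + 2) - 2 * (s + t + 1)" by simp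
  have d: "2 ^ Suc (Suc i) dvd s + t + 1" "2 ^ Suc (Suc i) dvd t ^ 2 + t + 2"
    unfolding 1 2 by (simp_all add: q_def)
  have "2 ^ Suc (Suc i) dvd t ^ 2 - 2 * s - t"
    unfolding 3 by (intro dvd_diff dvd_mult d)
  with d show ?case unfolding t_s by blast
qed auto

text \<open>Modulo 3 the roots are -1 and two elements of order 8, so \<open>t\<close> and
  \<open>s\<close> tend to -1 + w and -1 - w with w^2 = -2. The conjunct \<open>3 dvd t - 1\<close>
  is carried along to supply a factor 3 in the induction.\<close>

lemma cubic_sym3_cong:
  assumes "cubic_sym3 i = (t, s)"
  shows "3 ^ Suc i dvd s + t + 2 \<and> 3 ^ Suc i dvd t ^ 2 + 2 * t + 3 \<and> 3 dvd t - 1 \<and>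
         3 ^ Suc i dvd fst (cubic_sym3 (Suc i)) - t"
  using assms
proof (induction i arbitrary: t s)
  case (Suc i)
  obtain t' s' where eq: "cubic_sym3 i = (t', s')" by (cases "cubic_sym3 i")
  have ts: "t = t' ^ 3 - 3 * t' * s' + 3" "s = s' ^ 3 - 3 * t' * s' + 3" using Suc.prems eq by auto
  obtain u where u: "s' + t' + 2 = 3 ^ Suc i * u" using Suc.IH[OF eq] by (auto elim!: dvdE)
  obtain v where v: "t' ^ 2 + 2 * t' + 3 = 3 ^ Suc i * v" using Suc.IH[OF eq] by (auto elim!: dvdE)
  obtain w where w: "t' = 3 * w + 1" using Suc.IH[OF eq] by (auto elim!: dvdE simp: algebra_simps)
  define q :: int where "q = 3 ^ i"
  have uv: "s' = 3 * q * u - t' - 2" "t' ^ 2 + 2 * t' + 3 = 3 * q * v"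
    using u v by (auto simp: q_def)
  have "t = t' + (t' + 1) * (t' ^ 2 + 2 * t' + 3) - 9 * q * t' * u"
    unfolding ts uv(1) by (simp add: algebra_simps power2_eq_square power3_eq_cube)
  then have t_eq: "t = t' + 3 * q * ((t' + 1) * v - 3 * t' * u)"
    unfolding uv(2) by (simp add: algebra_simps)
  have 1: "s + t + 2 = 9 * q * (3 * q ^ 2 * u ^ 3 - 3 * q * u ^ 2 * (t' + 2) + u * (t' + 2) ^ 2 - 2 * t' * u)"
    unfolding ts uv(1) by (simp add: algebra_simps power2_eq_square power3_eq_cube)
  define d where "d = (t' + 1) * v - 3 * t' * u"
  have "t ^ 2 + 2 * t + 3 = (t' ^ 2 + 2 * t' + 3) + 6 * q * (t' + 1) * d + 9 * q ^ 2 * d ^ 2"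
    unfolding t_eq d_def[symmetric] by (simp add: algebra_simps power2_eq_square)
  also have "\<dots> = 3 * q * v * (1 + 2 * (t' + 1) ^ 2) - 18 * q * (t' + 1) * t' * u + 9 * q ^ 2 * d ^ 2"
    unfolding uv(2) by (simp add: d_def algebra_simps power2_eq_square)
  \<comment> \<open>This multiple of 3, due to \<open>t'\<close> being 1 modulo 3, raises the
    modulus from \<open>3 * q\<close> to \<open>9 * q\<close>.\<close>
  also have "1 + 2 * (t' + 1) ^ 2 = 3 * (6 * w ^ 2 + 8 * w + 3)"
    unfolding w by (simp add: algebra_simps power2_eq_square)
  finally have 2: "t ^ 2 + 2 * t + 3 =
      9 * q * (v * (6 * w ^ 2 + 8 * w + 3) - 2 * (t' + 1) * t' * u + q * d ^ 2)"
    by (simp add: algebra_simps power2_eq_square)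
  have t_s: "fst (cubic_sym3 (Suc (Suc i))) = t ^ 3 - 3 * t * s + 3" using Suc.prems by simp
  have 3: "t ^ 3 - 3 * t * s + 3 - t = (t + 1) * (t ^ 2 + 2 * t + 3) - 3 * t * (s + t + 2)"
    by (simp add: algebra_simps power2_eq_square power3_eq_cube)
  have dvd: "3 ^ Suc (Suc i) dvd s + t + 2" "3 ^ Suc (Suc i) dvd t ^ 2 + 2 * t + 3"
    unfolding 1 2 by (simp_all add: q_def)
  moreover have "3 dvd t - 1" unfolding t_eq w by (simp add: dvd_add)
  moreover have "3 ^ Suc (Suc i) dvd t ^ 3 - 3 * t * s + 3 - t"
    unfolding 3 by (intro dvd_diff dvd_mult dvd)
  ultimately show ?case unfolding t_s by blast
qed auto

section \<open>The product over the three roots as a norm\<close>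

text \<open>The norm of a + b X + c X^2 modulo the cubic. Negative terms are moved to the left and
  multiples and powers written out, so that additivity and multiplicativity of
  \<open>fps_reduce\<close> suffice to transport the formula.\<close>

lemma cubic_norm_form:
  fixes a b c l1 l2 l3 :: "'a::comm_ring_1"
  assumes "l1 + l2 + l3 = 1" "l1 * l2 + l1 * l3 + l2 * l3 = 0" "l1 * l2 * l3 = 1"
  shows "(a + b * l1 + c * l1 ^ 2) * (a + b * l2 + c * l2 ^ 2) * (a + b * l3 + c * l3 ^ 2)
      + (a * b * c + a * b * c + a * b * c + a * c * c + a * c * c)
    = a * a * a + a * a * b + a * a * c + b * b * b + b * b * c + c * c * c"
proof -
  define e1 where "e1 = l1 + l2 + l3"
  define e2 where "e2 = l1 * l2 + l1 * l3 + l2 * l3"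
  define e3 where "e3 = l1 * l2 * l3"
  have "(a + b * l1 + c * l1 ^ 2) * (a + b * l2 + c * l2 ^ 2) * (a + b * l3 + c * l3 ^ 2) =
      a ^ 3 + a ^ 2 * b * e1 + a ^ 2 * c * (e1 ^ 2 - 2 * e2) + a * b ^ 2 * e2
      + a * b * c * (e1 * e2 - 3 * e3) + a * c ^ 2 * (e2 ^ 2 - 2 * e1 * e3) + b ^ 3 * e3
      + b ^ 2 * c * e1 * e3 + b * c ^ 2 * e2 * e3 + c ^ 3 * e3 ^ 2"
    unfolding e1_def e2_def e3_def by (simp add: algebra_simps power2_eq_square power3_eq_cube)
  moreover have "e1 = 1" "e2 = 0" "e3 = 1" using assms by (simp_all add: e1_def e2_def e3_def)
  ultimately show ?thesis by (simp add: algebra_simps power2_eq_square power3_eq_cube)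
qed

text \<open>With \<open>f\<close> a projection, this is a component of F(lx) in the basis 1, l, l^2.
  It is the same for every root and has coefficients in the base field, so it commutes with
  reduction modulo \<open>p\<close>.\<close>

definition cubic_part :: "(int \<times> int \<times> int \<Rightarrow> int) \<Rightarrow> 'a::field fps \<Rightarrow> 'a fps" where
  "cubic_part f F = Abs_fps (\<lambda>n. of_int (f (cubic_coeffs n)) * fps_nth F n)"

lemma fps_ac_scale_cubic:
  fixes F :: "'a::field fps"
  assumes "l ^ 3 = l ^ 2 + 1"
  defines "A \<equiv> fps_ac_scale 1 (cubic_part fst F)"
    and "B \<equiv> fps_ac_scale 1 (cubic_part (\<lambda>x. fst (snd x)) F)"
    and "C \<equiv> fps_ac_scale 1 (cubic_part (\<lambda>x. snd (snd x)) F)"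
  shows "fps_ac_scale l F = A + B * fps_const l + C * fps_const l ^ 2"
proof (rule fps_ext)
  fix n
  obtain a b c where abc: "cubic_coeffs n = (a, b, c)" by (cases "cubic_coeffs n")
  show "fps_nth (fps_ac_scale l F) n = fps_nth (A + B * fps_const l + C * fps_const l ^ 2) n"
    using cubic_root_power[OF assms(1) abc]
    by (simp add: A_def B_def C_def cubic_part_def abc fps_const_power algebra_simps)
qed

lemma prod_fps_ac_scale_cubic:
  fixes F :: "'a::field fps"
  assumes "l1 + l2 + l3 = 1" "l1 * l2 + l1 * l3 + l2 * l3 = 0" "l1 * l2 * l3 = 1"
  defines "A \<equiv> cubic_part fst F"
    and "B \<equiv> cubic_part (\<lambda>x. fst (snd x)) F" and "C \<equiv> cubic_part (\<lambda>x. snd (snd x)) F"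
  shows "fps_ac_scale l1 F * fps_ac_scale l2 F * fps_ac_scale l3 F
      + fps_ac_scale 1 (A * B * C + A * B * C + A * B * C + A * C * C + A * C * C)
    = fps_ac_scale 1 (A * A * A + A * A * B + A * A * C + B * B * B + B * B * C + C * C * C)"
proof -
  have "fps_const l1 + fps_const l2 + fps_const l3 = 1"
    "fps_const l1 * fps_const l2 + fps_const l1 * fps_const l3 + fps_const l2 * fps_const l3 = 0"
    "fps_const l1 * fps_const l2 * fps_const l3 = 1"
    using assms(1-3) by simp_all
  note norm = cubic_norm_form[OF this, of "fps_ac_scale 1 A" "fps_ac_scale 1 B" "fps_ac_scale 1 C"]
  show ?thesis
    unfolding cubic_root_cube[OF assms(1-3), THEN fps_ac_scale_cubic]
      fps_ac_scale_add fps_ac_scale_mult A_def[symmetric] B_def[symmetric] C_def[symmetric]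
    by (rule norm)
qed

text \<open>The norm of x + y t, for t a root of X^2 + (p - 1) X + p, is a definite form in x and y.
  It is divisible by \<open>q\<close> and smaller than \<open>q\<close>, hence 0.\<close>

lemma quadratic_irrational:
  fixes t :: "nat \<Rightarrow> nat"
  assumes "p = 2 \<or> p = 3"
    and t: "\<And>i. int p ^ Suc i dvd int (t i) ^ 2 + (int p - 1) * int (t i) + int p"
  shows "\<exists>J. \<forall>x y. \<bar>x\<bar> \<le> int m \<longrightarrow> \<bar>y\<bar> \<le> int m \<longrightarrow>
           int (p ^ Suc J) dvd x + y * int (t J) \<longrightarrow> x = 0 \<and> y = 0"
proof -
  \<comment> \<open>The factor \<open>2 * p\<close> is the sum of the absolute values 1,
    \<open>p - 1\<close> and \<open>p\<close> of the coefficients of the norm form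
    \<open>N\<close>.\<close>
  define J where "J = 2 * p * m ^ 2"
  define q where "q = int (p ^ Suc J)"
  have "J < p ^ Suc J" using assms(1) by (intro less_trans[OF lessI power_gt_expt]) auto
  then have "int J < q" unfolding q_def by (simp only: of_nat_less_iff)
  then have q: "2 * int p * int m ^ 2 < q" unfolding J_def by simp
  have "x = 0 \<and> y = 0" if xy: "\<bar>x\<bar> \<le> int m" "\<bar>y\<bar> \<le> int m" "q dvd x + y * int (t J)" for x y
  proof -
    define N where "N = x ^ 2 - (int p - 1) * (x * y) + int p * y ^ 2"
    have "N = (x + y * int (t J)) * (x - y * int (t J) - (int p - 1) * y)
        + y ^ 2 * (int (t J) ^ 2 + (int p - 1) * int (t J) + int p)"
      by (simp add: N_def algebra_simps power2_eq_square)
    moreover have "q dvd int (t J) ^ 2 + (int p - 1) * int (t J) + int p"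
      using t[of J] by (simp add: q_def)
    ultimately have "q dvd N" using xy(3) by (simp add: dvd_add dvd_mult)
    have "\<bar>z * w\<bar> \<le> int m ^ 2" if "\<bar>z\<bar> \<le> int m" "\<bar>w\<bar> \<le> int m" for z w
      unfolding abs_mult power2_eq_square using that by (intro mult_mono) auto
    from this[OF xy(1,1)] this[OF xy(1,2)] this[OF xy(2,2)]
    have "\<bar>N\<bar> \<le> 2 * int p * int m ^ 2"
      using assms(1) unfolding N_def power2_eq_square abs_le_iff by (elim disjE) auto
    then have "N = 0" using \<open>q dvd N\<close> q zdvd_imp_le[of q "\<bar>N\<bar>"] by fastforce
    have "y = 0"
    proof -
      from assms(1) \<open>N = 0\<close> have "(2 * x - y) ^ 2 + 7 * y ^ 2 = 0 \<or> (x - y) ^ 2 + 2 * y ^ 2 = 0"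
        by (auto simp: N_def algebra_simps power2_eq_square)
      then show ?thesis
        by (auto simp: add_nonneg_eq_0_iff)
    qed
    with \<open>N = 0\<close> show ?thesis by (simp add: N_def)
  qed
  then show ?thesis unfolding q_def by blast
qed

text \<open>Power sums and recursive symmetric functions are integers with equal images in a field
  of characteristic 0, so the congruences for the latter carry over.\<close>

lemma cubic_power_sum_cong:
  assumes "p = 2 \<or> p = 3"
  shows "int p ^ Suc i dvd int (cubic_power_sum (p ^ Suc i)) - int (cubic_power_sum (p ^ i))"
    "int p ^ Suc i dvd int (cubic_power_sum (p ^ i)) ^ 2
       + (int p - 1) * int (cubic_power_sum (p ^ i)) + int p"
proof -
  obtain l1 l2 l3 :: "rat alg_closure" where
    l: "l1 + l2 + l3 = 1" "l1 * l2 + l1 * l3 + l2 * l3 = 0" "l1 * l2 * l3 = 1"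
    using cubic_roots_exist by blast
  have sym2: "int (cubic_power_sum (2 ^ i)) = fst (cubic_sym2 i)" for i
  proof -
    obtain t s where "cubic_sym2 i = (t, s)" by (cases "cubic_sym2 i")
    then have "(of_int (int (cubic_power_sum (2 ^ i))) :: rat alg_closure) = of_int (fst (cubic_sym2 i))"
      using cubic_sym2_eq[OF l, of i t s] cubic_power_sum_eq[OF l, of "2 ^ i"] by simp
    then show ?thesis by (simp only: of_int_eq_iff)
  qed
  have sym3: "int (cubic_power_sum (3 ^ i)) = fst (cubic_sym3 i)" for i
  proof -
    obtain t s where "cubic_sym3 i = (t, s)" by (cases "cubic_sym3 i")
    then have "(of_int (int (cubic_power_sum (3 ^ i))) :: rat alg_closure) = of_int (fst (cubic_sym3 i))"
      using cubic_sym3_eq[OF l, of i t s] cubic_power_sum_eq[OF l, of "3 ^ i"] by simp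
    then show ?thesis by (simp only: of_int_eq_iff)
  qed
  have *: "2 ^ Suc i dvd fst (cubic_sym2 (Suc i)) - fst (cubic_sym2 i)"
    "2 ^ Suc i dvd fst (cubic_sym2 i) ^ 2 + fst (cubic_sym2 i) + 2"
    using cubic_sym2_cong[of i "fst (cubic_sym2 i)" "snd (cubic_sym2 i)"] by simp_all
  have **: "3 ^ Suc i dvd fst (cubic_sym3 (Suc i)) - fst (cubic_sym3 i)"
    "3 ^ Suc i dvd fst (cubic_sym3 i) ^ 2 + 2 * fst (cubic_sym3 i) + 3"
    using cubic_sym3_cong[of i "fst (cubic_sym3 i)" "snd (cubic_sym3 i)"] by simp_all
  show "int p ^ Suc i dvd int (cubic_power_sum (p ^ Suc i)) - int (cubic_power_sum (p ^ i))"
    "int p ^ Suc i dvd int (cubic_power_sum (p ^ i)) ^ 2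
       + (int p - 1) * int (cubic_power_sum (p ^ i)) + int p"
    using assms * ** by (auto simp only: sym2 sym3 of_nat_numeral) simp_all
qed

text \<open>The norm formula is used twice. With roots in characteristic 0 it yields the rational
  identity \<open>artin_hasse_power p b + M = N\<close>, which can be reduced; with roots of the
  same cubic in characteristic p it turns the reduced identity back into a product of
  scalings.\<close>

lemma artin_hasse_transcendental_small_prime:
  assumes "CARD('p::prime_card) \<le> 3"
  shows "fps_transcendental (fps_reduce (artin_hasse CARD('p)) :: 'p mod_ring fps)"
proof -
  define p where "p = CARD('p)"
  have p: "prime p" "p > 1" "p = 2 \<or> p = 3"
  proof -
    show "prime p" unfolding p_def by (rule prime_card)
    then show "p > 1" by (rule prime_gt_1_nat)
    then show "p = 2 \<or> p = 3" using assms by (auto simp: p_def)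
  qed
  define t where "t i = cubic_power_sum (p ^ i)" for i
  have "t i \<le> t (Suc i)" for i
    unfolding t_def using p(2) by (intro cubic_power_sum_mono power_increasing) auto
  with cubic_power_sum_cong(1)[OF p(3)] obtain b where b: "\<And>i. digit_sum p b i = t i"
    using exists_digit_sum_eq[of t p] unfolding t_def by blast
  define E where "E = artin_hasse p"
  define A B C where "A = cubic_part fst E" and "B = cubic_part (\<lambda>x. fst (snd x)) E"
    and "C = cubic_part (\<lambda>x. snd (snd x)) E"
  define M where "M = A * B * C + A * B * C + A * B * C + A * C * C + A * C * C"
  define N where "N = A * A * A + A * A * B + A * A * C + B * B * B + B * B * C + C * C * C"
  have "artin_hasse_power p b + M = N"
  proof -
    obtain l1 l2 l3 :: "rat alg_closure" where
      l: "l1 + l2 + l3 = 1" "l1 * l2 + l1 * l3 + l2 * l3 = 0" "l1 * l2 * l3 = 1"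
      using cubic_roots_exist by blast
    have "fps_ac_scale 1 (artin_hasse_power p b) = (\<Prod>c\<leftarrow>[l1, l2, l3]. fps_ac_scale c E)"
      unfolding E_def using cubic_power_sum_eq[OF l] p(2)
      by (intro artin_hasse_power_eq_prod_scale) (simp_all add: b t_def add.assoc)
    then have "fps_ac_scale 1 (artin_hasse_power p b + M) = fps_ac_scale 1 N"
      using prod_fps_ac_scale_cubic[OF l, of E]
      by (simp add: fps_ac_scale_add[of _ "artin_hasse_power p b"] M_def N_def A_def B_def C_def mult.assoc)
    then show ?thesis by (simp only: fps_ac_scale_1_inject)
  qed
  then have "(fps_reduce (artin_hasse_power p b + M) :: 'p mod_ring fps) = fps_reduce N" by simp
  moreover define E' where "E' = (fps_reduce E :: 'p mod_ring fps)"
  have int_E: "p_integral_fps p E"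
    unfolding E_def p_def by (rule p_integral_artin_hasse)
  have int_part: "p_integral_fps p (cubic_part f E)" for f
    using int_E p(1) by (simp add: p_integral_fps_def cubic_part_def p_integral_mult)
  have reduce_part: "(fps_reduce (cubic_part f E) :: 'p mod_ring fps) = cubic_part f E'" for f
    using int_E p(1)
    by (simp add: fps_eq_iff fps_reduce_def cubic_part_def E'_def p_integral_fps_def rat_reduce_mult p_def)
  note int = int_part[of fst, folded A_def] int_part[of "\<lambda>x. fst (snd x)", folded B_def]
    int_part[of "\<lambda>x. snd (snd x)", folded C_def]
  define A' B' C' where "A' = cubic_part fst E'" and "B' = cubic_part (\<lambda>x. fst (snd x)) E'"
    and "C' = cubic_part (\<lambda>x. snd (snd x)) E'"
  have red: "fps_reduce A = A'" "fps_reduce B = B'" "fps_reduce C = C'"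
    by (simp_all only: A_def B_def C_def A'_def B'_def C'_def reduce_part)
  have mult: "(fps_reduce (F * G) :: 'p mod_ring fps) = fps_reduce F * fps_reduce G"
    and add: "(fps_reduce (F + G) :: 'p mod_ring fps) = fps_reduce F + fps_reduce G"
    if "p_integral_fps p F" "p_integral_fps p G" for F G
    using that fps_reduce_mult[where 'p = 'p] fps_reduce_add[where 'p = 'p] by (simp_all add: p_def)
  note closed = p_integral_fps_mult[OF p(1)] p_integral_fps_add[OF p(1)] int
  have "p_integral_fps p M" unfolding M_def by (intro closed)
  moreover have "fps_reduce M = A' * B' * C' + A' * B' * C' + A' * B' * C' + A' * C' * C' + A' * C' * C'"
    unfolding M_def by (simp only: mult add closed red)
  moreover have "fps_reduce N = A' * A' * A' + A' * A' * B' + A' * A' * C' + B' * B' * B' + B' * B' * C' + C' * C' * C'"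
    unfolding N_def by (simp only: mult add closed red)
  moreover have "p_integral_fps p (artin_hasse_power p b)"
    unfolding p_def by (rule p_integral_artin_hasse_power)
  ultimately have eq: "fps_reduce (artin_hasse_power p b)
      + (A' * B' * C' + A' * B' * C' + A' * B' * C' + A' * C' * C' + A' * C' * C')
    = A' * A' * A' + A' * A' * B' + A' * A' * C' + B' * B' * B' + B' * B' * C' + C' * C' * C'"
    by (simp only: add)
  obtain l1 l2 l3 :: "'p mod_ring alg_closure" where
    l: "l1 + l2 + l3 = 1" "l1 * l2 + l1 * l3 + l2 * l3 = 0" "l1 * l2 * l3 = 1"
    using cubic_roots_exist by blast
  have "fps_ac_scale 1 (fps_reduce (artin_hasse_power p b)) =
      (\<Prod>c\<leftarrow>[l1, l2, l3]. fps_ac_scale c (fps_reduce (artin_hasse p) :: 'p mod_ring fps))"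
    using prod_fps_ac_scale_cubic[OF l, of E', folded A'_def B'_def C'_def, folded eq]
    unfolding fps_ac_scale_add[of _ "fps_reduce (artin_hasse_power p b)"] E'_def E_def
    by (simp add: mult.assoc)
  moreover have "0 \<notin> set [l1, l2, l3]" using l(3) by auto
  ultimately show ?thesis
    unfolding p_def
    by (rule artin_hasse_transcendental_if_irrational_power)
       (use quadratic_irrational[OF p(3), of t] cubic_power_sum_cong(2)[OF p(3)] b
         in \<open>simp only: p_def[symmetric] t_def\<close>)
qed

theorem theorem1p1:
  fixes p :: nat
  assumes "prime p" and "p = CARD('p::prime_card)"
  shows "fps_transcendental (fps_reduce (artin_hasse p) :: 'p mod_ring fps)"
  using artin_hasse_transcendental_large_prime[where 'p = 'p]
    artin_hasse_transcendental_small_prime[where 'p = 'p] assms(2) by fastforce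

end
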